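(* Consider the stationary G/G/1/$\infty$ queue described in the context, with service times $\sigma_n(\theta)=G(\xi_n,\theta)$ depending on a real parameter $\theta$ in a compact interval $\Theta$, stationary workload $W_\theta(t)$, arrival times $(T_n)_{n\in\mathbb{Z}}$ with counting measure $A$, arrival intensity $\lambda$, and Palm probability $\mathbb{P}^0$ of the arrival process (expectation $\mathbb{E}^0$). Let $f$ be a real non-decreasing càdlàg function, let $\mu_f$ be the measure on $\mathbb{R}$ associated with $f$, and let $J(\theta)=\mathbb{E} f(W_\theta(0))$, where $\mathbb{E}$ is expectation under the stationary probability $\mathbb{P}$. Assume: (1) $\theta\mapsto G(\xi,\theta)$ is differentiable and Lipschitz, that is, $|G(\xi,\theta_1)-G(\xi,\theta_2)|\le K^\sigma(\xi)|\theta_1-\theta_2|$ for all $\theta_1,\theta_2\in\Theta$; (2) $\lambda\,\mathbb{E}^0\sigma_0^*<1$, where $\sigma^*_n=\sup_{\theta\in\Theta}\sigma_n(\theta)$; (3) $\mathbb{E}^0[K^\sigma(\xi_0)]^4<\infty$; (4) $\mathbb{E}^0[A([R_0^*,R_1^* ))]^4<\infty$; (5) $\mathbb{E}^0[f(W^*(0))]^2<\infty$ (in (3)–(5) the power is taken inside the expectation). Then $J$ admits a right derivative with respect to $\theta$ given by $$J'_r(\theta)=\lambda\,\mathbb{E}^0\Big[W'_\theta(0)\Big(f(W_\theta(0))-f(W_\theta(T_1-))-\mathbf{1}_{\{W'_\theta(0)<0\}}\big[\mu_f(\{W_\theta(0)\})-\mu_f(\{W_\theta(T_1-)\})\big]\Big)\Big],$$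 and its left derivative is $$J'_l(\theta)=\lambda\,\mathbb{E}^0\Big[W'_\theta(0)\Big(f(W_\theta(0))-f(W_\theta(T_1-))-\mathbf{1}_{\{W'_\theta(0)>0\}}\big[\mu_f(\{W_\theta(0)\})-\mu_f(\{W_\theta(T_1-)\})\big]\Big)\Big].$$
   Context: Stationary framework. $(\Omega,\mathcal{F},\mathbb{P})$ is a probability space with a measurable flow $(\vartheta_t)_{t\in\mathbb{R}}$ (jointly measurable in $(t,\omega)$, each $\vartheta_t$ bijective, $\vartheta_t\circ\vartheta_s=\vartheta_{t+s}$) preserving $\mathbb{P}$. The arrival times $(T_n)_{n\in\mathbb{Z}}$ form a simple point process, with the convention $T_0\le 0<T_1$, whose counting measure $A(C)=\sum_{n\in\mathbb{Z}}\mathbf{1}_C(T_n)$ is compatible with the flow, i.e. $A(\omega,C+t)=A(\vartheta_t\omega,C)$. Its intensity is $\lambda=\mathbb{E}[A((0,1])]$, and $\mathbb{P}^0$ is its Palm probability, characterised by $\lambda\,\mathbb{E}^0[Z(0)]=\frac1t\mathbb{E}\big[\int_{(0,t]}Z(s)\,A(ds)\big]$ for every non-negative process $Z$ with $Z(\omega,t)=Z(\vartheta_t\omega,0)$. Under $\mathbb{P}^0$, $T_0=0$ a.s. Service times. $F(\cdot,\theta)$ is the common distribution function of the service times, $G(\xi,\theta)=\sup\{x\ge0: F(x,\theta)\le\xi\}$, $(\xi_n)_{n\in\mathbb{Z}}$ is a sequence of random variables uniformly distributed on $[0,1]$, and $\sigma_n(\theta)=G(\xi_n,\theta)$ is the service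 time of the customer arriving at $T_n$; $(\sigma_n(\theta))_{n\in\mathbb{Z}}$ is an i.i.d. sequence. The basic stationary sequences are the inter-arrival times $\tau_n=T_{n+1}-T_n$ and the $\xi_n$, so the probability space does not depend on $\theta$. Workload. The queue is stationary, and its workload (remaining work at time $t$) $W_\theta(t)$ is a càdlàg process satisfying $W_\theta(t)=\big(W_\theta(T_n-)+\sigma_n(\theta)-(t-T_n)\big)^+$ for $t\in[T_n,T_{n+1})$, where $x^+=\max(x,0)$. The $*$-system is the queue with the same arrivals and service times $\sigma_n^*$; $W^*$ is its stationary workload, and $(R_k^* )_{k\in\mathbb{Z}}$, with $R_0^*\le0<R_1^*$, are the times at which arriving customers find the $*$-system empty. The $\theta$-systems are built from the sequence $(R_k^* )$ but with service times $\sigma_n(\theta)$, so that each $R_k^*$ is also the beginning of a busy period of the $\theta$-system and $W_\theta(t)\le W^*(t)$ for all $\theta\in\Theta$, $t\in\mathbb{R}$. $A([R_0^*,R_1^* ))$ is the number of arrivals in $[R_0^*,R_1^* )$. The prime in $W'_\theta$ denotes the derivative with respect to $\theta$; $W_\theta(T_1-)$ is the left limit of $W_\theta$ at $T_1$. Measure of $f$. $\mu_f$ is the measure with $\mu_f((x,y])=f(y)-f(x)$ for all $x\le y$.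
   Formalization: Assumes f is left-continuous at 0 (with a jump there the formulas fail, e.g. f = 1 on [0,∞) and 0 below) and that J(θ) is finite on Θ (not implied by (1)–(5)); W'_θ(0) is read as the right derivative in J'_r and the left derivative in J'_l. *)

theory Defs
  imports "HOL-Probability.Probability"
begin

definition left_lim :: "(real \<Rightarrow> real) \<Rightarrow> real \<Rightarrow> real" where
  "left_lim g t = Lim (at_left t) g"

definition cadlag :: "(real \<Rightarrow> real) \<Rightarrow> bool" where
  "cadlag g \<longleftrightarrow>
     (\<forall>t. continuous (at_right t) g) \<and> (\<forall>t. \<exists>l. (g \<longlongrightarrow> l) (at_left t))"

(* A derivative relative to a compact interval (in particular, a two-sided derivative) is also the
   value of the library's vector_derivative along each one-sided filter inside the interval. *)

lemma vector_derivative_at_right_eq: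
  fixes g :: "real \<Rightarrow> real"
  assumes "(g has_real_derivative d) (at x within {a..b})" "a \<le> x" "x < b"
  shows "vector_derivative g (at_right x) = d"
proof -
  have "at x within {x..b} = at_right x"
    using assms(3) by (rule at_within_Icc_at_right)
  moreover have "(g has_real_derivative d) (at x within {x..b})"
    by (rule has_field_derivative_subset[OF assms(1)]) (use assms in auto)
  ultimately have "(g has_vector_derivative d) (at_right x)"
    by (simp add: has_real_derivative_iff_has_vector_derivative)
  then show ?thesis
    by (intro vector_derivative_within) auto
qed

lemma vector_derivative_at_left_eq:
  fixes g :: "real \<Rightarrow> real"
  assumes "(g has_real_derivative d) (at x within {a..b})" "a < x" "x \<le> b"
  shows "vector_derivative g (at_left x) = d"
proof -
  have "at x within {a..x} = at_left x"
    using assms(2) by (rule at_within_Icc_at_left)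
  moreover have "(g has_real_derivative d) (at x within {a..x})"
    by (rule has_field_derivative_subset[OF assms(1)]) (use assms in auto)
  ultimately have "(g has_vector_derivative d) (at_left x)"
    by (simp add: has_real_derivative_iff_has_vector_derivative)
  then show ?thesis
    by (intro vector_derivative_within) auto
qed


locale stationary_flow = prob_space M for M :: "'a measure" +
  fixes flow :: "real \<Rightarrow> 'a \<Rightarrow> 'a"
  assumes flow_measurable: "(\<lambda>(t, \<omega>). flow t \<omega>) \<in> measurable (borel \<Otimes>\<^sub>M M) M"
    and flow_bij: "\<And>t. bij_betw (flow t) (space M) (space M)"
    and flow_add: "\<And>s t \<omega>. \<omega> \<in> space M \<Longrightarrow> flow t (flow s \<omega>) = flow (t + s) \<omega>"
    and flow_preserves: "\<And>t. distr M M (flow t) = M"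

(* The counting measure of the points T n, n ranging over the integers. *)
definition arrivals :: "(int \<Rightarrow> 'a \<Rightarrow> real) \<Rightarrow> 'a \<Rightarrow> real measure" where
  "arrivals T \<omega> = distr (count_space UNIV) borel (\<lambda>n. T n \<omega>)"

lemma emeasure_arrivals:
  assumes "C \<in> sets borel"
  shows "emeasure (arrivals T \<omega>) C = (\<integral>\<^sup>+n. indicator C (T n \<omega>) \<partial>count_space UNIV)"
proof -
  have "emeasure (arrivals T \<omega>) C = (\<integral>\<^sup>+x. indicator C x \<partial>arrivals T \<omega>)"
    using assms by (simp add: arrivals_def)
  also have "\<dots> = (\<integral>\<^sup>+n. indicator C (T n \<omega>) \<partial>count_space UNIV)"
    using assms unfolding arrivals_def by (subst nn_integral_distr) auto
  finally show ?thesis .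
qed

definition intensity :: "'a measure \<Rightarrow> (int \<Rightarrow> 'a \<Rightarrow> real) \<Rightarrow> real" where
  "intensity M T = (\<integral>\<omega>. measure (arrivals T \<omega>) {0<..1} \<partial>M)"

locale stationary_arrivals = stationary_flow M flow
  for M :: "'a measure" and flow +
  fixes T :: "int \<Rightarrow> 'a \<Rightarrow> real"
  assumes T_measurable: "\<And>n. T n \<in> borel_measurable M"
    and T_simple: "\<And>\<omega>. \<omega> \<in> space M \<Longrightarrow> strict_mono (\<lambda>n. T n \<omega>)"
    and T_at_top: "\<And>\<omega>. \<omega> \<in> space M \<Longrightarrow> filterlim (\<lambda>n. T n \<omega>) at_top at_top"
    and T_at_bot: "\<And>\<omega>. \<omega> \<in> space M \<Longrightarrow> filterlim (\<lambda>n. T n \<omega>) at_bot at_bot"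
    and T_origin: "\<And>\<omega>. \<omega> \<in> space M \<Longrightarrow> T 0 \<omega> \<le> 0 \<and> 0 < T 1 \<omega>"
    and arrivals_compatible:
      "\<And>\<omega> t C. \<omega> \<in> space M \<Longrightarrow> C \<in> sets borel \<Longrightarrow>
         emeasure (arrivals T \<omega>) ((\<lambda>x. x + t) ` C) = emeasure (arrivals T (flow t \<omega>)) C"
    and finite_intensity: "integrable M (\<lambda>\<omega>. measure (arrivals T \<omega>) {0<..1})"

locale palm_framework = stationary_arrivals M flow T
  for M :: "'a measure" and flow and T +
  fixes P0 :: "'a measure"
  assumes palm_prob_space: "prob_space P0"
    and sets_palm: "sets P0 = sets M"
    and palm:
      "\<And>(Z :: 'a \<times> real \<Rightarrow> ennreal) t.
         Z \<in> borel_measurable (M \<Otimes>\<^sub>M borel) \<Longrightarrow>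
         (\<And>\<omega> s. \<omega> \<in> space M \<Longrightarrow> Z (\<omega>, s) = Z (flow s \<omega>, 0)) \<Longrightarrow>
         0 < t \<Longrightarrow>
         ennreal (intensity M T) * (\<integral>\<^sup>+\<omega>. Z (\<omega>, 0) \<partial>P0)
           = ennreal (1 / t) * (\<integral>\<^sup>+\<omega>. (\<integral>\<^sup>+s\<in>{0<..t}. Z (\<omega>, s) \<partial>arrivals T \<omega>) \<partial>M)"


(* The supremum is taken in [0, \<infinity>), so that the empty set has supremum 0; this is what
   inserting 0 does.  For \<xi> < 1 the set is bounded when F _ \<theta> is a distribution function;
   at \<xi> = 1 it is not, and the value is a meaningless real number. *)
definition quantile :: "(real \<Rightarrow> real \<Rightarrow> real) \<Rightarrow> real \<Rightarrow> real \<Rightarrow> real" where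
  "quantile F \<xi> \<theta> = Sup (insert 0 {x. 0 \<le> x \<and> F x \<theta> \<le> \<xi>})"

definition service ::
  "(real \<Rightarrow> real \<Rightarrow> real) \<Rightarrow> (int \<Rightarrow> 'a \<Rightarrow> real) \<Rightarrow> real \<Rightarrow> int \<Rightarrow> 'a \<Rightarrow> real" where
  "service F \<xi> \<theta> n \<omega> = quantile F (\<xi> n \<omega>) \<theta>"

definition max_service ::
  "(real \<Rightarrow> real \<Rightarrow> real) \<Rightarrow> (int \<Rightarrow> 'a \<Rightarrow> real) \<Rightarrow> real set \<Rightarrow> int \<Rightarrow> 'a \<Rightarrow> real" where
  "max_service F \<xi> \<Theta> n \<omega> = (SUP \<theta>\<in>\<Theta>. service F \<xi> \<theta> n \<omega>)"

definition stationary_workload ::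
  "'a measure \<Rightarrow> (real \<Rightarrow> 'a \<Rightarrow> 'a) \<Rightarrow> (int \<Rightarrow> 'a \<Rightarrow> real) \<Rightarrow> (int \<Rightarrow> 'a \<Rightarrow> real)
     \<Rightarrow> (real \<Rightarrow> 'a \<Rightarrow> real) \<Rightarrow> bool" where
  "stationary_workload M flow T S V \<longleftrightarrow>
     (\<forall>t. V t \<in> borel_measurable M) \<and>
     (\<forall>\<omega>\<in>space M.
        cadlag (\<lambda>t. V t \<omega>) \<and>
        (\<forall>t. V t \<omega> = V 0 (flow t \<omega>)) \<and>
        (\<forall>n. \<forall>t\<in>{T n \<omega>..<T (n + 1) \<omega>}.
           V t \<omega> = max 0 (left_lim (\<lambda>s. V s \<omega>) (T n \<omega>) + S n \<omega> - (t - T n \<omega>))))"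

(* W \<theta> t \<omega> is the workload of the \<theta>-system at time t, Wstar that of the *-system.
   The assumption xi_compatible is the usual way to say that the marks form a stationary sequence:
   under P0 it makes (T (n + 1) - T n, \<xi> n), n ranging over the integers, jointly stationary. *)
locale gg1_queue = palm_framework M flow T P0
  for M :: "'a measure" and flow and T and P0 +
  fixes \<Theta> :: "real set"
    and F :: "real \<Rightarrow> real \<Rightarrow> real"
    and \<xi> :: "int \<Rightarrow> 'a \<Rightarrow> real"
    and W :: "real \<Rightarrow> real \<Rightarrow> 'a \<Rightarrow> real"
    and Wstar :: "real \<Rightarrow> 'a \<Rightarrow> real"
    and R :: "int \<Rightarrow> 'a \<Rightarrow> real"
  assumes xi_measurable: "\<And>n. \<xi> n \<in> borel_measurable M"
    and xi_compatible: "\<And>n \<omega>. \<omega> \<in> space M \<Longrightarrow> \<xi> n \<omega> = \<xi> 0 (flow (T n \<omega>) \<omega>)"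
    and xi_uniform: "\<And>n. distr P0 borel (\<xi> n) = uniform_measure lborel {0..1}"
    and service_cdf:
      "\<And>\<theta> n x. \<theta> \<in> \<Theta> \<Longrightarrow> F x \<theta> = cdf (distr P0 borel (service F \<xi> \<theta> n)) x"
    and service_indep:
      "\<And>\<theta>. \<theta> \<in> \<Theta> \<Longrightarrow> prob_space.indep_vars P0 (\<lambda>_. borel) (service F \<xi> \<theta>) UNIV"
    and W_workload:
      "\<And>\<theta>. \<theta> \<in> \<Theta> \<Longrightarrow> stationary_workload M flow T (service F \<xi> \<theta>) (W \<theta>)"
    and Wstar_workload: "stationary_workload M flow T (max_service F \<xi> \<Theta>) Wstar"
    and R_strict_mono: "\<And>\<omega>. \<omega> \<in> space M \<Longrightarrow> strict_mono (\<lambda>k. R k \<omega>)"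
    and R_origin: "\<And>\<omega>. \<omega> \<in> space M \<Longrightarrow> R 0 \<omega> \<le> 0 \<and> 0 < R 1 \<omega>"
    and R_range:
      "\<And>\<omega>. \<omega> \<in> space M \<Longrightarrow>
         range (\<lambda>k. R k \<omega>) = {T n \<omega> | n. left_lim (\<lambda>s. Wstar s \<omega>) (T n \<omega>) = 0}"
    and W_starts_at_R:
      "\<And>\<theta> k \<omega>. \<theta> \<in> \<Theta> \<Longrightarrow> \<omega> \<in> space M \<Longrightarrow> left_lim (\<lambda>s. W \<theta> s \<omega>) (R k \<omega>) = 0"
    and W_le_Wstar:
      "\<And>\<theta> t \<omega>. \<theta> \<in> \<Theta> \<Longrightarrow> \<omega> \<in> space M \<Longrightarrow> W \<theta> t \<omega> \<le> Wstar t \<omega>"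

end

theory Submission
  imports Defs
begin

text \<open>
  Between two arrivals the workload decreases at unit speed, so the Palm inversion formula turns
  \<open>J(\<theta>) - f(0)\<close> into \<open>\<lambda> E\<^sup>0[h(W\<^sub>\<theta>(0))]\<close>, where
  \<open>h(w) = \<integral>\<^sub>0\<^bsup>\<tau>\<^esup> (f((w - u)\<^sup>+) - f(0)) du\<close> and \<open>\<tau> = T\<^sub>1\<close>.
  The function \<open>h\<close> has the one-sided derivatives \<open>f(w) - f((w - \<tau>)\<^sup>+)\<close> on the right and the
  same expression with left limits of \<open>f\<close> on the left; the sign of \<open>W'\<^sub>\<theta>(0)\<close> decides which one
  enters the chain rule. Difference quotients are dominated by
  \<open>(f(W\<^sup>*(0)) - f(0)) \<Sum> |K(\<xi>\<^sub>n)|\<close>, summed over the arrivals of the current cycle up to the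
  origin. By shift invariance of the Palm probability, the second moment of this sum is at most
  \<open>E\<^sup>0[A\<^sup>2 K(\<xi>\<^sub>0)\<^sup>2]\<close> with \<open>A\<close> the number of arrivals in the cycle.
\<close>

section \<open>Stationary point processes and their Palm probability\<close>

text \<open>Where \<open>f\<close> jumps, the pathwise difference quotients of
  \<open>f (W \<phi> 0 \<omega>)\<close> may blow up, so differentiation under the stationary
  expectation is out of reach directly. Averaging over an interarrival interval removes this
  obstacle: whatever the jumps of \<open>f\<close>, the averaged cost is Lipschitz on every
  half-line bounded above. The reflection in Lindley's recursion leaves only one-sided derivatives
  in \<theta>, even for differentiable service times. Differentiation therefore takes place along a
  set \<open>S\<close> on one side of \<theta>, with \<sigma> = 1 or \<sigma> = -1 naming the side,
  so that one argument serves both formulas. An empty system is the delicate case. There the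
  averaged cost ignores a jump of \<open>f\<close> at 0, while the formula contains the atom at 0 of
  the measure of \<open>f\<close>; left continuity of \<open>f\<close> at 0 makes the two agree. The
  moment orders come from two uses of 2xy \<le> x^2 + y^2: one separates the Lipschitz constant of
  the workload from the size of the cost, the other separates the cycle length from
  \<open>K\<close>.\<close>

lemma strict_mono_int_succ_ge:
  fixes u v :: "int \<Rightarrow> real"
  assumes u: "strict_mono u" and v: "strict_mono v" and r: "range u \<subseteq> range v"
    and "u k \<ge> v k"
  shows "u (k + 1) \<ge> v (k + 1)"
proof -
  obtain j where j: "u (k + 1) = v j"
    using r by blast
  have "v k < v j"
    using assms(4) strict_monoD[OF u, of k "k + 1"] j by simp
  then have "k + 1 \<le> j"
    using strict_mono_less[OF v] by force
  then show ?thesis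
    using j strict_mono_less_eq[OF v] by simp
qed

lemma strict_mono_int_pred_le:
  fixes u v :: "int \<Rightarrow> real"
  assumes u: "strict_mono u" and v: "strict_mono v" and r: "range u \<subseteq> range v"
    and "u k \<le> v k"
  shows "u (k - 1) \<le> v (k - 1)"
proof -
  obtain j where j: "u (k - 1) = v j"
    using r by blast
  have "v j < v k"
    using assms(4) strict_monoD[OF u, of "k - 1" k] j by simp
  then have "j \<le> k - 1"
    using strict_mono_less[OF v] by force
  then show ?thesis
    using j strict_mono_less_eq[OF v] by simp
qed

text \<open>The numbering of a point configuration is determined by its set of points and the
  convention at the origin. The indices 0 agree because each is the last point not exceeding 0; the
  two preceding lemmas, used in both directions, carry the equality up and down.\<close>

lemma strict_mono_int_unique:
  fixes u v :: "int \<Rightarrow> real"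
  assumes u: "strict_mono u" and v: "strict_mono v" and r: "range u = range v"
    and "u 0 \<le> 0" "0 < u 1" "v 0 \<le> 0" "0 < v 1"
  shows "u k = v k"
proof (induction k rule: int_induct[where k = 0])
  case base
  have *: "p 0 \<le> q 0"
    if "strict_mono q" "range p \<subseteq> range q" "p 0 \<le> 0" "0 < q 1" for p q :: "int \<Rightarrow> real"
  proof -
    obtain j where j: "p 0 = q j"
      using \<open>range p \<subseteq> range q\<close> by blast
    then have "q j < q 1"
      using that by simp
    then have "j \<le> 0"
      using strict_mono_less[OF that(1)] by force
    then show ?thesis
      using j strict_mono_less_eq[OF that(1)] by simp
  qed
  show ?case
    using *[of v u] *[of u v] assms by force
next
  case (step1 i)
  then show ?case
    using strict_mono_int_succ_ge[of u v i] strict_mono_int_succ_ge[of v u i] u v r by force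
next
  case (step2 i)
  then show ?case
    using strict_mono_int_pred_le[of u v i] strict_mono_int_pred_le[of v u i] u v r by force
qed

context stationary_flow
begin

lemma flow_space [simp]: "\<omega> \<in> space M \<Longrightarrow> flow t \<omega> \<in> space M"
  using flow_bij bij_betwE by blast

lemma flow_zero [simp]: "\<omega> \<in> space M \<Longrightarrow> flow 0 \<omega> = \<omega>"
  using flow_add[of \<omega> 0 0] flow_bij[of 0] by (auto simp: bij_betw_def inj_on_def)

lemma measurable_flow_random:
  assumes "S \<in> borel_measurable N" "g \<in> measurable N M"
  shows "(\<lambda>x. flow (S x) (g x)) \<in> measurable N M"
  using measurable_compose[OF measurable_Pair[OF assms] flow_measurable] by simp

lemma measurable_flow [measurable]: "flow t \<in> measurable M M"
  using measurable_flow_random[of "\<lambda>_. t" M "\<lambda>x. x"] by simp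

lemma nn_integral_flow:
  assumes "X \<in> borel_measurable M"
  shows "(\<integral>\<^sup>+\<omega>. X (flow t \<omega>) \<partial>M) = (\<integral>\<^sup>+\<omega>. X \<omega> \<partial>M)"
  using nn_integral_distr[of "flow t" M M X] assms flow_preserves by simp

end

context stationary_arrivals
begin

lemmas T_meas [measurable] = T_measurable

lemma arrival_index:
  assumes "\<omega> \<in> space M"
  obtains n where "T n \<omega> \<le> t" "t < T (n + 1) \<omega>"
proof -
  obtain p where p: "t < T p \<omega>"
    using T_at_top[OF assms] by (auto simp: filterlim_at_top_dense eventually_at_top_linorder)
  obtain q where q: "T q \<omega> \<le> t"
    using T_at_bot[OF assms] by (auto simp: filterlim_at_bot eventually_at_bot_linorder)
  have "q \<le> p"
    using p q strict_mono_less_eq[OF T_simple[OF assms], of p q] by linarith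
  \<comment> \<open>Discrete intermediate value argument: in the induction step either
    \<open>t < T i \<omega>\<close> and the hypothesis applies, or \<open>i\<close> is the index
    sought.\<close>
  then have "t < T p \<omega> \<longrightarrow> (\<exists>n. T n \<omega> \<le> t \<and> t < T (n + 1) \<omega>)"
  proof (induction p rule: int_ge_induct)
    case base
    then show ?case using q by simp
  next
    case (step i)
    then show ?case by (metis not_le)
  qed
  then show thesis
    using p that by blast
qed

lemma emeasure_arrivals_singleton_eq_0:
  "emeasure (arrivals T \<omega>) {x} = 0 \<longleftrightarrow> x \<notin> range (\<lambda>n. T n \<omega>)"
  unfolding arrivals_def by (subst emeasure_distr) (auto simp: emeasure_count_space_eq_0)

text \<open>Compatibility of the counting measures, tested on singletons, already locates the points
  of the shifted configuration; their numbering is settled separately.\<close>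

lemma range_T_flow:
  assumes "\<omega> \<in> space M"
  shows "x \<in> range (\<lambda>n. T n (flow t \<omega>)) \<longleftrightarrow> x + t \<in> range (\<lambda>n. T n \<omega>)"
  using arrivals_compatible[OF assms, of "{x}" t]
    emeasure_arrivals_singleton_eq_0[of \<omega> "x + t"]
    emeasure_arrivals_singleton_eq_0[of "flow t \<omega>" x] by simp

text \<open>Both sides enumerate the same set increasingly, and the condition on \<open>N\<close>
  gives index 0 to the last arrival not exceeding \<open>t\<close>, so the enumerations coincide by
  uniqueness.\<close>

lemma T_flow:
  assumes \<omega>: "\<omega> \<in> space M" and N: "T N \<omega> \<le> t" "t < T (N + 1) \<omega>"
  shows "T k (flow t \<omega>) = T (k + N) \<omega> - t"
proof (rule strict_mono_int_unique[where u = "\<lambda>k. T k (flow t \<omega>)" and v = "\<lambda>k. T (k + N) \<omega> - t"])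
  show "strict_mono (\<lambda>k. T k (flow t \<omega>))"
    using \<omega> by (simp add: T_simple)
  show "strict_mono (\<lambda>k. T (k + N) \<omega> - t)"
    using T_simple[OF \<omega>] by (auto simp: strict_mono_def)
  show "range (\<lambda>k. T k (flow t \<omega>)) = range (\<lambda>k. T (k + N) \<omega> - t)"
  proof (intro set_eqI)
    fix x
    have "x \<in> range (\<lambda>k. T k (flow t \<omega>)) \<longleftrightarrow> (\<exists>n. x + t = T n \<omega>)"
      using range_T_flow[OF \<omega>, of x t] by auto
    also have "\<dots> \<longleftrightarrow> (\<exists>k. x = T (k + N) \<omega> - t)"
      by (metis add_diff_cancel diff_add_cancel)
    finally show "x \<in> range (\<lambda>k. T k (flow t \<omega>)) \<longleftrightarrow> x \<in> range (\<lambda>k. T (k + N) \<omega> - t)"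
      by auto
  qed
qed (use \<omega> N T_origin[of "flow t \<omega>"] in \<open>auto simp: add.commute\<close>)

lemma T_flow_arrival:
  assumes "\<omega> \<in> space M"
  shows "T k (flow (T n \<omega>) \<omega>) = T (k + n) \<omega> - T n \<omega>"
  using T_flow[OF assms, of n "T n \<omega>" k] strict_monoD[OF T_simple[OF assms], of n "n + 1"] by simp

lemma nn_integral_arrivals:
  assumes \<omega>: "\<omega> \<in> space M" and N: "T N \<omega> \<le> t" "t < T (N + 1) \<omega>"
    and Z: "Z \<in> borel_measurable borel"
  shows "(\<integral>\<^sup>+s\<in>{0<..t}. Z s \<partial>arrivals T \<omega>) = (\<Sum>k\<in>{1..N}. Z (T k \<omega>))"
proof -
  note T_less = strict_mono_less[OF T_simple[OF \<omega>]] and T_le = strict_mono_less_eq[OF T_simple[OF \<omega>]]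
  have iff: "T k \<omega> \<in> {0<..t} \<longleftrightarrow> k \<in> {1..N}" for k
  proof -
    have "T k \<omega> > 0 \<longleftrightarrow> k \<ge> 1"
      using T_origin[OF \<omega>] T_le[of k 0] T_le[of 1 k] by linarith
    moreover have "T k \<omega> \<le> t \<longleftrightarrow> k \<le> N"
      using N T_le[of k N] T_le[of "N + 1" k] by linarith
    ultimately show ?thesis by simp
  qed
  have "(\<integral>\<^sup>+s\<in>{0<..t}. Z s \<partial>arrivals T \<omega>)
      = (\<integral>\<^sup>+n. Z (T n \<omega>) * indicator {0<..t} (T n \<omega>) \<partial>count_space UNIV)"
    unfolding arrivals_def using Z by (subst nn_integral_distr) auto
  also have "\<dots> = (\<Sum>k\<in>{1..N}. Z (T k \<omega>) * indicator {0<..t} (T k \<omega>))"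
    using iff by (intro nn_integral_count_space') (auto simp: indicator_def)
  also have "\<dots> = (\<Sum>k\<in>{1..N}. Z (T k \<omega>))"
    using iff by (intro sum.cong refl) (simp add: indicator_def)
  finally show ?thesis .
qed

lemma measure_arrivals_Ico:
  assumes \<omega>: "\<omega> \<in> space M" and "i \<le> j"
  shows "measure (arrivals T \<omega>) {T i \<omega>..<T j \<omega>} = real_of_int (j - i)"
proof -
  have "(\<lambda>n. T n \<omega>) -` {T i \<omega>..<T j \<omega>} = {i..<j}"
    using strict_mono_less[OF T_simple[OF \<omega>]] strict_mono_less_eq[OF T_simple[OF \<omega>]] by auto
  then have "emeasure (arrivals T \<omega>) {T i \<omega>..<T j \<omega>} = of_nat (nat (j - i))"
    unfolding arrivals_def by (subst emeasure_distr) auto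
  then show ?thesis
    using assms by (simp add: measure_def)
qed

text \<open>Since \<open>T 1 \<omega>\<close> is the first arrival after 0, the index of the last
  arrival up to time 1 is also the number of arrivals in (0, 1].\<close>

definition arrival_count :: "'a \<Rightarrow> int" where
  "arrival_count \<omega> = (THE n. T n \<omega> \<le> 1 \<and> 1 < T (n + 1) \<omega>)"

lemma arrival_count_unique:
  assumes \<omega>: "\<omega> \<in> space M" and n: "T n \<omega> \<le> 1" "1 < T (n + 1) \<omega>"
  shows "arrival_count \<omega> = n"
  unfolding arrival_count_def
proof (rule the_equality)
  fix m assume m: "T m \<omega> \<le> 1 \<and> 1 < T (m + 1) \<omega>"
  have "T m \<omega> < T (n + 1) \<omega>" "T n \<omega> < T (m + 1) \<omega>"
    using n m by linarith+
  then show "m = n"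
    using strict_mono_less[OF T_simple[OF \<omega>]] by fastforce
qed (use n in auto)

lemma arrival_count:
  assumes "\<omega> \<in> space M"
  shows "T (arrival_count \<omega>) \<omega> \<le> 1" "1 < T (arrival_count \<omega> + 1) \<omega>"
  using arrival_count_unique[OF assms] arrival_index[OF assms, of 1] by metis+

lemma arrival_count_nonneg:
  assumes "\<omega> \<in> space M"
  shows "0 \<le> arrival_count \<omega>"
proof -
  have "T 0 \<omega> < T (arrival_count \<omega> + 1) \<omega>"
    using T_origin[OF assms] arrival_count(2)[OF assms] by linarith
  then show ?thesis
    using strict_mono_less[OF T_simple[OF assms]] by fastforce
qed

lemma measurable_arrival_count [measurable]: "arrival_count \<in> measurable M (count_space UNIV)"
proof -
  have "arrival_count -` {n} \<inter> space M = {\<omega> \<in> space M. T n \<omega> \<le> 1 \<and> 1 < T (n + 1) \<omega>}" for n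
    using arrival_count arrival_count_unique by auto
  moreover have "{\<omega> \<in> space M. T n \<omega> \<le> 1 \<and> 1 < T (n + 1) \<omega>} \<in> sets M" for n
    by measurable
  ultimately show ?thesis
    by (simp add: measurable_count_space_eq2_countable)
qed

lemma measurable_flow_arrival [measurable]: "(\<lambda>\<omega>. flow (T n \<omega>) \<omega>) \<in> measurable M M"
  by (rule measurable_flow_random) auto

text \<open>The summation range is random but takes countably many values, and on each of them the
  sum has a fixed range.\<close>

lemma measurable_arrival_sum:
  fixes V :: "'a \<Rightarrow> ennreal"
  assumes [measurable]: "V \<in> borel_measurable M"
  shows "(\<lambda>\<omega>. \<Sum>k\<in>{1..arrival_count \<omega>}. V (flow (T k \<omega>) \<omega>)) \<in> borel_measurable M"
  by (rule measurable_compose_countable'[where I = UNIV and g = arrival_count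
        and f = "\<lambda>n \<omega>. \<Sum>k\<in>{1..n}. V (flow (T k \<omega>) \<omega>)"]) auto

end

section \<open>The Palm relation as a sum over the arrivals in a unit interval\<close>

context palm_framework
begin

lemmas sets_P0 [measurable_cong] = sets_palm

lemma space_P0 [simp]: "space P0 = space M"
  using sets_eq_imp_space_eq[OF sets_palm] .

text \<open>The characterisation of the Palm probability for t = 1 and the process Z(\<omega>, s) =
  \<open>V (flow s \<omega>)\<close>, which is stationary because \<open>flow 0\<close> is the
  identity. Only finitely many arrivals lie in (0, 1], so the inner integral is a finite
  sum.\<close>

lemma palm_sum:
  assumes V [measurable]: "V \<in> borel_measurable M"
  shows "ennreal (intensity M T) * (\<integral>\<^sup>+\<omega>. V \<omega> \<partial>P0)
    = (\<integral>\<^sup>+\<omega>. (\<Sum>k\<in>{1..arrival_count \<omega>}. V (flow (T k \<omega>) \<omega>)) \<partial>M)"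
proof -
  have m: "(\<lambda>(\<omega>, s). V (flow s \<omega>)) \<in> borel_measurable (M \<Otimes>\<^sub>M borel)"
    using measurable_compose[OF measurable_flow_random[of snd "M \<Otimes>\<^sub>M borel" fst] V]
    by (simp add: case_prod_beta')
  have "ennreal (intensity M T) * (\<integral>\<^sup>+\<omega>. V \<omega> \<partial>P0)
      = ennreal (intensity M T) * (\<integral>\<^sup>+\<omega>. V (flow 0 \<omega>) \<partial>P0)"
    by (intro arg_cong2[where f = "(*)"] refl nn_integral_cong) simp
  also have "\<dots> = (\<integral>\<^sup>+\<omega>. (\<integral>\<^sup>+s\<in>{0<..1}. V (flow s \<omega>) \<partial>arrivals T \<omega>) \<partial>M)"
    using palm[OF m, of 1] by simp
  also have "\<dots> = (\<integral>\<^sup>+\<omega>. (\<Sum>k\<in>{1..arrival_count \<omega>}. V (flow (T k \<omega>) \<omega>)) \<partial>M)"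
  proof (rule nn_integral_cong)
    fix \<omega> assume \<omega>: "\<omega> \<in> space M"
    have "(\<lambda>s. V (flow s \<omega>)) \<in> borel_measurable borel"
      using measurable_compose[OF measurable_flow_random[of "\<lambda>s. s" borel "\<lambda>_. \<omega>"] V] \<omega> by simp
    then show "(\<integral>\<^sup>+s\<in>{0<..1}. V (flow s \<omega>) \<partial>arrivals T \<omega>)
        = (\<Sum>k\<in>{1..arrival_count \<omega>}. V (flow (T k \<omega>) \<omega>))"
      using nn_integral_arrivals[OF \<omega>, of "arrival_count \<omega>" 1] arrival_count[OF \<omega>] by blast
  qed
  finally show ?thesis .
qed

end

text \<open>Telescoping in additive form: differences are unreliable in \<open>ennreal\<close>, so
  both boundary terms stay on their own sides until they are known to be finite.\<close>

lemma sum_int_telescope_ennreal: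
  fixes v :: "int \<Rightarrow> ennreal"
  assumes "0 \<le> N"
  shows "(\<Sum>k\<in>{1..N}. v k) + v (N + 1) = v 1 + (\<Sum>k\<in>{1..N}. v (k + 1))"
  using assms
proof (induction N rule: int_ge_induct)
  case base
  then show ?case by simp
next
  case (step i)
  have "{1..i + 1} = insert (i + 1) {1..i}"
    using step by auto
  then show ?case
    using step by (simp add: ac_simps)
qed

lemma nn_integral_Ico_split:
  fixes Y :: "real \<Rightarrow> ennreal"
  assumes [measurable]: "Y \<in> borel_measurable borel" and "a \<le> b" "b \<le> c"
  shows "(\<integral>\<^sup>+u\<in>{a..<c}. Y u \<partial>lborel) = (\<integral>\<^sup>+u\<in>{a..<b}. Y u \<partial>lborel) + (\<integral>\<^sup>+u\<in>{b..<c}. Y u \<partial>lborel)"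
proof -
  have "(\<integral>\<^sup>+u\<in>{a..<c}. Y u \<partial>lborel)
      = (\<integral>\<^sup>+u. Y u * indicator {a..<b} u + Y u * indicator {b..<c} u \<partial>lborel)"
    using assms(2,3) by (intro nn_integral_cong) (auto simp: indicator_def)
  also have "\<dots> = (\<integral>\<^sup>+u\<in>{a..<b}. Y u \<partial>lborel) + (\<integral>\<^sup>+u\<in>{b..<c}. Y u \<partial>lborel)"
    by (rule nn_integral_add) auto
  finally show ?thesis .
qed

lemma nn_integral_Ico_shift:
  fixes Y :: "real \<Rightarrow> ennreal"
  assumes [measurable]: "Y \<in> borel_measurable borel"
  shows "(\<integral>\<^sup>+u\<in>{0..<b - a}. Y (u + a) \<partial>lborel) = (\<integral>\<^sup>+u\<in>{a..<b}. Y u \<partial>lborel)"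
  using nn_integral_real_affine[of "\<lambda>u. Y u * indicator {a..<b} u" 1 a]
  by (simp add: add.commute indicator_def less_diff_eq)

lemma nn_integral_Ico_sum:
  fixes Y :: "real \<Rightarrow> ennreal" and \<tau> :: "int \<Rightarrow> real"
  assumes Y [measurable]: "Y \<in> borel_measurable borel" and "mono \<tau>" and "0 \<le> N"
  shows "(\<Sum>k\<in>{1..N}. \<integral>\<^sup>+u\<in>{\<tau> k..<\<tau> (k + 1)}. Y u \<partial>lborel)
    = (\<integral>\<^sup>+u\<in>{\<tau> 1..<\<tau> (N + 1)}. Y u \<partial>lborel)"
  using \<open>0 \<le> N\<close>
proof (induction N rule: int_ge_induct)
  case base
  then show ?case by simp
next
  case (step i)
  have "{1..i + 1} = insert (i + 1) {1..i}"
    using step by auto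
  moreover have "\<tau> 1 \<le> \<tau> (i + 1)" "\<tau> (i + 1) \<le> \<tau> (i + 1 + 1)"
    using \<open>mono \<tau>\<close> step by (auto intro: monoD)
  ultimately show ?case
    using step nn_integral_Ico_split[OF Y, of "\<tau> 1" "\<tau> (i + 1)" "\<tau> (i + 1 + 1)"]
    by (simp add: ac_simps)
qed

section \<open>Inversion formula and invariance of the Palm probability\<close>

context palm_framework
begin

text \<open>When the origin is an arrival this covers a whole interarrival interval; under the
  stationary law it covers only the residual part after the origin.\<close>

definition interval_integral :: "('a \<Rightarrow> ennreal) \<Rightarrow> 'a \<Rightarrow> ennreal" where
  "interval_integral X \<omega> = (\<integral>\<^sup>+u\<in>{0..<T 1 \<omega>}. X (flow u \<omega>) \<partial>lborel)"

lemma measurable_along_flow: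
  assumes "X \<in> borel_measurable M"
  shows "(\<lambda>(\<omega>, u). X (flow u \<omega>)) \<in> borel_measurable (M \<Otimes>\<^sub>M borel)"
  using measurable_compose[OF measurable_flow_random[of snd "M \<Otimes>\<^sub>M borel" fst] assms]
  by (simp add: case_prod_beta')

lemma measurable_path:
  assumes "X \<in> borel_measurable M" "\<omega> \<in> space M"
  shows "(\<lambda>u. X (flow u \<omega>)) \<in> borel_measurable borel"
  using measurable_compose[OF measurable_flow_random[of "\<lambda>s. s" borel "\<lambda>_. \<omega>"] assms(1)] assms(2)
  by simp

lemma measurable_interval_integral [measurable]:
  assumes [measurable]: "X \<in> borel_measurable M"
  shows "interval_integral X \<in> borel_measurable M"
proof -
  have [measurable]: "(\<lambda>p. X (flow (snd p) (fst p))) \<in> borel_measurable (M \<Otimes>\<^sub>M borel)"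
    using measurable_along_flow[OF assms] by (simp add: case_prod_beta')
  have "(\<lambda>p. X (flow (snd p) (fst p)) * (if 0 \<le> snd p \<and> snd p < T 1 (fst p) then 1 else 0))
      \<in> borel_measurable (M \<Otimes>\<^sub>M borel)"
    by measurable
  then have "(\<lambda>(\<omega>, u). X (flow u \<omega>) * indicator {0..<T 1 \<omega>} u) \<in> borel_measurable (M \<Otimes>\<^sub>M lborel)"
    by (simp add: case_prod_beta' indicator_def)
  then show ?thesis
    unfolding interval_integral_def by (rule lborel.borel_measurable_nn_integral)
qed

lemma interval_integral_flow:
  assumes X: "X \<in> borel_measurable M" and \<omega>: "\<omega> \<in> space M"
    and N: "T N \<omega> \<le> t" "t < T (N + 1) \<omega>"
  shows "interval_integral X (flow t \<omega>) = (\<integral>\<^sup>+u\<in>{t..<T (N + 1) \<omega>}. X (flow u \<omega>) \<partial>lborel)"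
proof -
  have "interval_integral X (flow t \<omega>)
      = (\<integral>\<^sup>+u\<in>{0..<T (N + 1) \<omega> - t}. X (flow (u + t) \<omega>) \<partial>lborel)"
    unfolding interval_integral_def using T_flow[OF \<omega> N, of 1] flow_add[OF \<omega>]
    by (simp add: add.commute)
  also have "\<dots> = (\<integral>\<^sup>+u\<in>{t..<T (N + 1) \<omega>}. X (flow u \<omega>) \<partial>lborel)"
    by (rule nn_integral_Ico_shift[OF measurable_path[OF X \<omega>]])
  finally show ?thesis .
qed

text \<open>The integrals between consecutive arrivals, summed over the arrivals in \<open>(0, 1]\<close>, give the
  integral over \<open>[0, 1)\<close> up to two boundary terms. By stationarity these have the same
  expectation; it has to be finite to cancel them.\<close>

lemma palm_inversion_finite:
  assumes X [measurable]: "X \<in> borel_measurable M"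
    and fin: "(\<integral>\<^sup>+\<omega>. interval_integral X \<omega> \<partial>M) < \<infinity>"
  shows "ennreal (intensity M T) * (\<integral>\<^sup>+\<omega>. interval_integral X \<omega> \<partial>P0) = (\<integral>\<^sup>+\<omega>. X \<omega> \<partial>M)"
proof -
  define S where "S \<omega> = (\<Sum>k\<in>{1..arrival_count \<omega>}. interval_integral X (flow (T k \<omega>) \<omega>))" for \<omega>
  have S [measurable]: "S \<in> borel_measurable M"
    unfolding S_def by (rule measurable_arrival_sum) measurable
  have path_meas: "(\<lambda>(\<omega>, u). X (flow u \<omega>) * indicator {0..<1} u) \<in> borel_measurable (M \<Otimes>\<^sub>M lborel)"
    using measurable_along_flow[OF X] by (simp add: case_prod_beta')
  have unit [measurable]: "(\<lambda>\<omega>. \<integral>\<^sup>+u\<in>{0..<1}. X (flow u \<omega>) \<partial>lborel) \<in> borel_measurable M"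
    using path_meas by (rule lborel.borel_measurable_nn_integral)
  have path: "interval_integral X \<omega> + S \<omega>
      = (\<integral>\<^sup>+u\<in>{0..<1}. X (flow u \<omega>) \<partial>lborel) + interval_integral X (flow 1 \<omega>)"
    if \<omega>: "\<omega> \<in> space M" for \<omega>
  proof -
    let ?N = "arrival_count \<omega>"
    let ?Y = "\<lambda>u. X (flow u \<omega>)"
    have m: "?Y \<in> borel_measurable borel"
      by (rule measurable_path[OF X \<omega>])
    have inc: "mono (\<lambda>k. T k \<omega>)"
      using T_simple[OF \<omega>] by (rule strict_mono_mono)
    note N = arrival_count[OF \<omega>] arrival_count_nonneg[OF \<omega>]
    have "S \<omega> = (\<Sum>k\<in>{1..?N}. \<integral>\<^sup>+u\<in>{T k \<omega>..<T (k + 1) \<omega>}. ?Y u \<partial>lborel)"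
      unfolding S_def using strict_monoD[OF T_simple[OF \<omega>]]
      by (intro sum.cong refl interval_integral_flow[OF X \<omega>]) auto
    also have "\<dots> = (\<integral>\<^sup>+u\<in>{T 1 \<omega>..<T (?N + 1) \<omega>}. ?Y u \<partial>lborel)"
      by (rule nn_integral_Ico_sum[OF m inc N(3)])
    finally have "interval_integral X \<omega> + S \<omega> = (\<integral>\<^sup>+u\<in>{0..<T (?N + 1) \<omega>}. ?Y u \<partial>lborel)"
      unfolding interval_integral_def
      using nn_integral_Ico_split[OF m, of 0 "T 1 \<omega>" "T (?N + 1) \<omega>"] T_origin[OF \<omega>] N(3)
        monoD[OF inc, of 1 "?N + 1"] by simp
    \<comment> \<open>The overshoot beyond time 1 is the residual integral seen from the origin
      moved to time 1.\<close>
    also have "\<dots> = (\<integral>\<^sup>+u\<in>{0..<1}. ?Y u \<partial>lborel) + (\<integral>\<^sup>+u\<in>{1..<T (?N + 1) \<omega>}. ?Y u \<partial>lborel)"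
      using nn_integral_Ico_split[OF m, of 0 1 "T (?N + 1) \<omega>"] N by simp
    finally show ?thesis
      using interval_integral_flow[OF X \<omega> N(1,2)] by simp
  qed
  have unit_eq: "(\<integral>\<^sup>+\<omega>. (\<integral>\<^sup>+u\<in>{0..<1}. X (flow u \<omega>) \<partial>lborel) \<partial>M) = (\<integral>\<^sup>+\<omega>. X \<omega> \<partial>M)"
  proof -
    interpret pair_sigma_finite M lborel ..
    have "(\<integral>\<^sup>+\<omega>. (\<integral>\<^sup>+u\<in>{0..<1}. X (flow u \<omega>) \<partial>lborel) \<partial>M)
        = (\<integral>\<^sup>+u. (\<integral>\<^sup>+\<omega>. X (flow u \<omega>) * indicator {0..<1} u \<partial>M) \<partial>lborel)"
      using Fubini'[OF path_meas] by simp
    also have "\<dots> = (\<integral>\<^sup>+u. (\<integral>\<^sup>+\<omega>. X \<omega> \<partial>M) * indicator {0..<1::real} u \<partial>lborel)"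
      by (simp add: nn_integral_multc nn_integral_flow[OF X])
    also have "\<dots> = (\<integral>\<^sup>+\<omega>. X \<omega> \<partial>M)"
      by (simp add: nn_integral_cmult)
    finally show ?thesis .
  qed
  have "(\<integral>\<^sup>+\<omega>. interval_integral X \<omega> \<partial>M) + (\<integral>\<^sup>+\<omega>. S \<omega> \<partial>M)
      = (\<integral>\<^sup>+\<omega>. interval_integral X \<omega> + S \<omega> \<partial>M)"
    by (rule nn_integral_add[symmetric]) measurable
  also have "\<dots> = (\<integral>\<^sup>+\<omega>. (\<integral>\<^sup>+u\<in>{0..<1}. X (flow u \<omega>) \<partial>lborel) + interval_integral X (flow 1 \<omega>) \<partial>M)"
    by (intro nn_integral_cong path)
  also have "\<dots> = (\<integral>\<^sup>+\<omega>. (\<integral>\<^sup>+u\<in>{0..<1}. X (flow u \<omega>) \<partial>lborel) \<partial>M)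
      + (\<integral>\<^sup>+\<omega>. interval_integral X (flow 1 \<omega>) \<partial>M)"
    by (rule nn_integral_add) measurable
  also have "\<dots> = (\<integral>\<^sup>+\<omega>. interval_integral X \<omega> \<partial>M) + (\<integral>\<^sup>+\<omega>. X \<omega> \<partial>M)"
    by (simp add: unit_eq nn_integral_flow[of "interval_integral X"] add.commute)
  finally have "(\<integral>\<^sup>+\<omega>. S \<omega> \<partial>M) = (\<integral>\<^sup>+\<omega>. X \<omega> \<partial>M)"
    using fin by (auto simp: ennreal_add_left_cancel)
  then show ?thesis
    using palm_sum[of "interval_integral X"] by (simp add: S_def)
qed

theorem palm_inversion:
  assumes X [measurable]: "X \<in> borel_measurable M"
  shows "ennreal (intensity M T) * (\<integral>\<^sup>+\<omega>. interval_integral X \<omega> \<partial>P0) = (\<integral>\<^sup>+\<omega>. X \<omega> \<partial>M)"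
proof -
  \<comment> \<open>The length of the interval containing the origin may have infinite mean, hence the cut-off.\<close>
  define Xm where "Xm m \<omega> = (if T 1 \<omega> - T 0 \<omega> \<le> real m then min (of_nat m) (X \<omega>) else 0)" for m \<omega>
  have Xm [measurable]: "Xm m \<in> borel_measurable M" for m
    unfolding Xm_def by measurable
  have mono: "mono (\<lambda>m. Xm m \<omega>)" for \<omega>
  proof (rule monoI)
    fix m n :: nat assume "m \<le> n"
    then have "min (of_nat m) (X \<omega>) \<le> min (of_nat n) (X \<omega>)"
      by (intro min.mono of_nat_mono order_refl)
    then show "Xm m \<omega> \<le> Xm n \<omega>"
      using \<open>m \<le> n\<close> by (simp add: Xm_def)
  qed
  have sup: "(SUP m. Xm m \<omega>) = X \<omega>" for \<omega>
  proof (rule LIMSEQ_unique[OF LIMSEQ_SUP])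
    show "incseq (\<lambda>m. Xm m \<omega>)"
      by (rule mono)
    have "((\<lambda>m. min (of_nat m) (X \<omega>)) \<longlongrightarrow> min \<top> (X \<omega>)) sequentially"
      by (intro tendsto_min tendsto_const) (simp add: of_nat_tendsto_top_ennreal)
    moreover have "\<forall>\<^sub>F m in sequentially. min (of_nat m) (X \<omega>) = Xm m \<omega>"
      using eventually_ge_at_top[of "nat \<lceil>T 1 \<omega> - T 0 \<omega>\<rceil>"]
      by eventually_elim (auto simp: Xm_def nat_le_iff ceiling_le_iff)
    ultimately show "(\<lambda>m. Xm m \<omega>) \<longlonglongrightarrow> X \<omega>"
      by (simp add: top.extremum inf_min[symmetric] Lim_transform_eventually)
  qed
  have fin: "(\<integral>\<^sup>+\<omega>. interval_integral (Xm m) \<omega> \<partial>M) < \<infinity>" for m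
  proof -
    have "interval_integral (Xm m) \<omega> \<le> ennreal (real m * real m)" if \<omega>: "\<omega> \<in> space M" for \<omega>
    proof -
      note o = T_origin[OF \<omega>]
      \<comment> \<open>The length of the interval around the origin does not change while
        \<open>u\<close> stays below \<open>T 1 \<omega>\<close>. If it exceeds \<open>m\<close>,
        the integrand vanishes; otherwise u < \<open>T 1 \<omega>\<close> \<le>
        \<open>T 1 \<omega> - T 0 \<omega>\<close> \<le> m.\<close>
      have le: "Xm m (flow u \<omega>) * indicator {0..<T 1 \<omega>} u \<le> of_nat m * indicator {0..real m} u" for u
      proof (cases "u \<in> {0..<T 1 \<omega>}")
        case True
        then have "T k (flow u \<omega>) = T k \<omega> - u" for k
          using T_flow[OF \<omega>, of 0 u k] o by simp
        then have "Xm m (flow u \<omega>) \<noteq> 0 \<Longrightarrow> u \<le> real m"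
          using True o by (auto simp: Xm_def split: if_splits)
        then show ?thesis
          using True by (cases "Xm m (flow u \<omega>) = 0") (auto simp: indicator_def Xm_def)
      qed simp
      have "interval_integral (Xm m) \<omega> \<le> (\<integral>\<^sup>+u. of_nat m * indicator {0..real m} u \<partial>lborel)"
        unfolding interval_integral_def by (intro nn_integral_mono le)
      also have "\<dots> = ennreal (real m * real m)"
        by (simp add: nn_integral_cmult ennreal_of_nat_eq_real_of_nat ennreal_mult)
      finally show ?thesis .
    qed
    then have "(\<integral>\<^sup>+\<omega>. interval_integral (Xm m) \<omega> \<partial>M) \<le> (\<integral>\<^sup>+\<omega>. ennreal (real m * real m) \<partial>M)"
      by (intro nn_integral_mono)
    also have "\<dots> < \<infinity>"
      by (simp add: emeasure_space_1)
    finally show ?thesis .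
  qed
  have int_sup: "(SUP m. interval_integral (Xm m) \<omega>) = interval_integral X \<omega>"
    if \<omega>: "\<omega> \<in> space M" for \<omega>
  proof -
    have [measurable]: "(\<lambda>u. Xm m (flow u \<omega>)) \<in> borel_measurable borel" for m
      using measurable_path[OF Xm \<omega>] .
    have "(\<integral>\<^sup>+u. (SUP m. Xm m (flow u \<omega>) * indicator {0..<T 1 \<omega>} u) \<partial>lborel)
        = (SUP m. interval_integral (Xm m) \<omega>)"
      unfolding interval_integral_def
      by (rule nn_integral_monotone_convergence_SUP)
         (auto intro!: monoI le_funI mult_right_mono monoD[OF mono])
    then show ?thesis
      by (simp add: SUP_mult_right_ennreal[symmetric] sup interval_integral_def)
  qed
  have mono_int: "incseq (\<lambda>m. interval_integral (Xm m))"
    unfolding interval_integral_def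
    by (auto intro!: monoI le_funI nn_integral_mono mult_right_mono monoD[OF mono])
  have "(\<integral>\<^sup>+\<omega>. interval_integral X \<omega> \<partial>P0) = (\<integral>\<^sup>+\<omega>. (SUP m. interval_integral (Xm m) \<omega>) \<partial>P0)"
    by (intro nn_integral_cong) (simp add: int_sup)
  also have "\<dots> = (SUP m. \<integral>\<^sup>+\<omega>. interval_integral (Xm m) \<omega> \<partial>P0)"
    by (rule nn_integral_monotone_convergence_SUP[OF mono_int]) measurable
  finally have "ennreal (intensity M T) * (\<integral>\<^sup>+\<omega>. interval_integral X \<omega> \<partial>P0)
      = (SUP m. ennreal (intensity M T) * (\<integral>\<^sup>+\<omega>. interval_integral (Xm m) \<omega> \<partial>P0))"
    by (simp add: SUP_mult_left_ennreal)
  also have "\<dots> = (SUP m. \<integral>\<^sup>+\<omega>. Xm m \<omega> \<partial>M)"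
    using palm_inversion_finite[OF Xm fin] by simp
  also have "\<dots> = (\<integral>\<^sup>+\<omega>. (SUP m. Xm m \<omega>) \<partial>M)"
    by (rule nn_integral_monotone_convergence_SUP[symmetric])
       (auto intro!: monoI le_funI monoD[OF mono])
  finally show ?thesis
    by (simp add: sup)
qed

text \<open>Inversion of the constant 1 writes the total mass 1 as a multiple of the intensity. The
  product stays 0 for zero intensity even if the mean interval length is infinite.\<close>

lemma intensity_pos: "0 < intensity M T"
proof (rule ccontr)
  assume "\<not> 0 < intensity M T"
  then have "(\<integral>\<^sup>+\<omega>. (\<lambda>_. 1) \<omega> \<partial>M) = (0 :: ennreal)"
    using palm_inversion[of "\<lambda>_. 1"] by (simp add: ennreal_neg)
  then show False
    by (simp add: emeasure_space_1)
qed

text \<open>Replacing each arrival in (0, 1] by its successor changes the sum over these arrivals by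
  two boundary terms, one seen from time 0 and one from time 1; by stationarity they have equal
  expectations. To cancel them they must be finite, hence the proof for indicators followed by
  equality of measures.\<close>

theorem palm_invariant:
  assumes X: "X \<in> borel_measurable M"
  shows "(\<integral>\<^sup>+\<omega>. X (flow (T 1 \<omega>) \<omega>) \<partial>P0) = (\<integral>\<^sup>+\<omega>. X \<omega> \<partial>P0)"
proof -
  define s where "s \<omega> = flow (T 1 \<omega>) \<omega>" for \<omega>
  have s [measurable]: "s \<in> measurable M M"
    unfolding s_def by measurable
  have *: "(\<integral>\<^sup>+\<omega>. indicator B (s \<omega>) \<partial>P0) = (\<integral>\<^sup>+\<omega>. indicator B \<omega> \<partial>P0)"
    if B [measurable]: "B \<in> sets M" for B
  proof -
    define v where "v \<omega> = (indicator B \<omega> :: ennreal)" for \<omega>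
    have v [measurable]: "v \<in> borel_measurable M"
      unfolding v_def by measurable
    define S where "S V \<omega> = (\<Sum>k\<in>{1..arrival_count \<omega>}. V (flow (T k \<omega>) \<omega>))"
      for V :: "'a \<Rightarrow> ennreal" and \<omega>
    have S [measurable]: "S V \<in> borel_measurable M" if "V \<in> borel_measurable M" for V
      unfolding S_def using that by (rule measurable_arrival_sum)
    have s_flow: "s (flow t \<omega>) = flow (T (n + 1) \<omega>) \<omega>"
      if "\<omega> \<in> space M" "T n \<omega> \<le> t" "t < T (n + 1) \<omega>" for n t \<omega>
      unfolding s_def using T_flow[OF that, of 1] flow_add[OF that(1)] by (simp add: add.commute)
    have path: "S v \<omega> + v (s (flow 1 \<omega>)) = v (s \<omega>) + S (\<lambda>\<omega>. v (s \<omega>)) \<omega>"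
      if \<omega>: "\<omega> \<in> space M" for \<omega>
    proof -
      have "S (\<lambda>\<omega>. v (s \<omega>)) \<omega> = (\<Sum>k\<in>{1..arrival_count \<omega>}. v (flow (T (k + 1) \<omega>) \<omega>))"
        unfolding S_def using strict_monoD[OF T_simple[OF \<omega>]]
        by (intro sum.cong refl arg_cong[where f = v] s_flow[OF \<omega>]) auto
      moreover have "s (flow 1 \<omega>) = flow (T (arrival_count \<omega> + 1) \<omega>) \<omega>"
        by (rule s_flow[OF \<omega> arrival_count[OF \<omega>]])
      ultimately show ?thesis
        using sum_int_telescope_ennreal[OF arrival_count_nonneg[OF \<omega>],
            of "\<lambda>k. v (flow (T k \<omega>) \<omega>)"] by (simp add: S_def s_def)
    qed
    have fin: "(\<integral>\<^sup>+\<omega>. v (s \<omega>) \<partial>M) \<noteq> \<infinity>"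
    proof -
      have "(\<integral>\<^sup>+\<omega>. v (s \<omega>) \<partial>M) \<le> (\<integral>\<^sup>+\<omega>. 1 \<partial>M)"
        by (intro nn_integral_mono) (auto simp: v_def indicator_def)
      then show ?thesis
        by (auto simp: emeasure_space_1 top_unique)
    qed
    have "(\<integral>\<^sup>+\<omega>. v (s \<omega>) \<partial>M) + (\<integral>\<^sup>+\<omega>. S v \<omega> \<partial>M)
        = (\<integral>\<^sup>+\<omega>. S v \<omega> \<partial>M) + (\<integral>\<^sup>+\<omega>. v (s (flow 1 \<omega>)) \<partial>M)"
      using nn_integral_flow[of "\<lambda>\<omega>. v (s \<omega>)" 1] by (simp add: add.commute)
    also have "\<dots> = (\<integral>\<^sup>+\<omega>. S v \<omega> + v (s (flow 1 \<omega>)) \<partial>M)"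
      by (rule nn_integral_add[symmetric]) measurable
    also have "\<dots> = (\<integral>\<^sup>+\<omega>. v (s \<omega>) + S (\<lambda>\<omega>. v (s \<omega>)) \<omega> \<partial>M)"
      by (intro nn_integral_cong path)
    also have "\<dots> = (\<integral>\<^sup>+\<omega>. v (s \<omega>) \<partial>M) + (\<integral>\<^sup>+\<omega>. S (\<lambda>\<omega>. v (s \<omega>)) \<omega> \<partial>M)"
      by (rule nn_integral_add) measurable
    finally have "(\<integral>\<^sup>+\<omega>. S v \<omega> \<partial>M) = (\<integral>\<^sup>+\<omega>. S (\<lambda>\<omega>. v (s \<omega>)) \<omega> \<partial>M)"
      using fin by (simp add: ennreal_add_left_cancel)
    then have "ennreal (intensity M T) * (\<integral>\<^sup>+\<omega>. v \<omega> \<partial>P0)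
        = ennreal (intensity M T) * (\<integral>\<^sup>+\<omega>. v (s \<omega>) \<partial>P0)"
      using palm_sum[OF v] palm_sum[of "\<lambda>\<omega>. v (s \<omega>)"] by (simp add: S_def)
    then show ?thesis
      using intensity_pos by (simp add: ennreal_mult_cancel_left v_def)
  qed
  have "distr P0 P0 s = P0"
  proof (rule measure_eqI)
    fix B assume "B \<in> sets (distr P0 P0 s)"
    then have B: "B \<in> sets M"
      by (simp add: sets_palm)
    have "emeasure (distr P0 P0 s) B = (\<integral>\<^sup>+\<omega>. indicator B \<omega> \<partial>distr P0 P0 s)"
      using B by (simp add: sets_palm)
    also have "\<dots> = (\<integral>\<^sup>+\<omega>. indicator B (s \<omega>) \<partial>P0)"
      using B by (intro nn_integral_distr) (auto simp: sets_palm)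
    finally show "emeasure (distr P0 P0 s) B = emeasure P0 B"
      using *[OF B] B by (simp add: sets_palm)
  qed simp
  then have "(\<integral>\<^sup>+\<omega>. X \<omega> \<partial>P0) = (\<integral>\<^sup>+\<omega>. X \<omega> \<partial>distr P0 P0 s)"
    by simp
  also have "\<dots> = (\<integral>\<^sup>+\<omega>. X (s \<omega>) \<partial>P0)"
    using X by (intro nn_integral_distr) auto
  finally show ?thesis
    by (simp add: s_def)
qed

text \<open>The right side is taken at \<open>T 0 \<omega>\<close> rather than at the origin itself,
  so that the induction starts from an identity.\<close>

theorem palm_invariant_arrival:
  assumes X: "X \<in> borel_measurable M"
  shows "(\<integral>\<^sup>+\<omega>. X (flow (T (int n) \<omega>) \<omega>) \<partial>P0) = (\<integral>\<^sup>+\<omega>. X (flow (T 0 \<omega>) \<omega>) \<partial>P0)"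
proof (induction n)
  case (Suc n)
  have "(\<integral>\<^sup>+\<omega>. X (flow (T (int (Suc n)) \<omega>) \<omega>) \<partial>P0)
      = (\<integral>\<^sup>+\<omega>. X (flow (T (int n) (flow (T 1 \<omega>) \<omega>)) (flow (T 1 \<omega>) \<omega>)) \<partial>P0)"
    by (intro nn_integral_cong) (simp add: T_flow_arrival flow_add add.commute)
  also have "\<dots> = (\<integral>\<^sup>+\<omega>. X (flow (T (int n) \<omega>) \<omega>) \<partial>P0)"
    by (rule palm_invariant[of "\<lambda>\<omega>. X (flow (T (int n) \<omega>) \<omega>)"]) (use X in measurable)
  finally show ?case
    using Suc by simp
qed simp

end

section \<open>One-sided derivatives and primitives of monotone functions\<close>

text \<open>The difference quotient factors as \<open>q y * s (g y)\<close>. If \<open>d\<close> is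
  nonzero, the sign of \<sigma> * d tells from which side \<open>g y\<close> approaches
  \<open>g x\<close>, hence which slope of \<open>H\<close> appears. If \<open>d = 0\<close>, the
  side may oscillate, but \<open>s\<close> is bounded near \<open>g x\<close> and \<open>q\<close>
  tends to 0.\<close>

lemma has_real_derivative_one_sided_compose:
  fixes g H :: "real \<Rightarrow> real"
  assumes g: "(g has_real_derivative d) (at x within S)"
    and S: "\<And>y. y \<in> S \<Longrightarrow> y \<noteq> x \<Longrightarrow> 0 < \<sigma> * (y - x)"
    and hr: "(H has_real_derivative hr) (at_right (g x))"
    and hl: "(H has_real_derivative hl) (at_left (g x))"
  shows "((\<lambda>y. H (g y)) has_real_derivative d * (if \<sigma> * d < 0 then hl else hr)) (at x within S)"
proof -
  define s where "s z = (H z - H (g x)) / (z - g x)" for z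
  define q where "q y = (g y - g x) / (y - x)" for y
  have sr: "(s \<longlongrightarrow> hr) (at_right (g x))" and sl: "(s \<longlongrightarrow> hl) (at_left (g x))"
    using hr hl by (simp_all add: has_field_derivative_iff s_def[abs_def])
  have q: "(q \<longlongrightarrow> d) (at x within S)"
    using g by (simp add: has_field_derivative_iff q_def[abs_def])
  have cont: "(g \<longlongrightarrow> g x) (at x within S)"
    using DERIV_continuous[OF g] by (simp add: continuous_within)
  have in_S: "\<forall>\<^sub>F y in at x within S. 0 < \<sigma> * (y - x)"
    using S by (auto simp: eventually_at_filter)
  \<comment> \<open>This also covers \<open>g y = g x\<close>, where both sides are 0 because
    division by zero gives 0.\<close>
  have sq: "(H (g y) - H (g x)) / (y - x) = q y * s (g y)" for y
    by (simp add: s_def q_def)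
  have "((\<lambda>y. q y * s (g y)) \<longlongrightarrow> d * (if \<sigma> * d < 0 then hl else hr)) (at x within S)"
  proof (cases "d = 0")
    case True
    let ?C = "\<bar>hr\<bar> + \<bar>hl\<bar> + 1"
    have "\<forall>\<^sub>F z in at_right (g x). \<bar>s z\<bar> < ?C"
      using order_tendstoD(2)[OF tendsto_rabs[OF sr], of ?C] by simp
    moreover have "\<forall>\<^sub>F z in at_left (g x). \<bar>s z\<bar> < ?C"
      using order_tendstoD(2)[OF tendsto_rabs[OF sl], of ?C] by simp
    ultimately have "\<forall>\<^sub>F z in at (g x). \<bar>s z\<bar> < ?C"
      by (simp add: eventually_at_split)
    \<comment> \<open>The point \<open>g x\<close> itself may be included because
      \<open>s (g x) = 0\<close>; the path \<open>g\<close> may return to it infinitely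
      often.\<close>
    then have "\<forall>\<^sub>F z in nhds (g x). \<bar>s z\<bar> < ?C"
      unfolding eventually_at_filter by eventually_elim (fastforce simp: s_def)
    then have "\<forall>\<^sub>F y in at x within S. \<bar>s (g y)\<bar> < ?C"
      using cont by (auto simp: filterlim_iff)
    then have "\<forall>\<^sub>F y in at x within S. norm (q y * s (g y)) \<le> norm (q y) * ?C"
      by eventually_elim (simp add: abs_mult mult_left_mono)
    with q True show ?thesis
      by (simp add: tendsto_0_le)
  next
    case False
    have "((\<lambda>y. q y * d) \<longlongrightarrow> d * d) (at x within S)"
      by (intro tendsto_intros q)
    moreover have "0 < d * d"
      using False not_real_square_gt_zero by blast
    ultimately have "\<forall>\<^sub>F y in at x within S. 0 < q y * d"
      by (rule order_tendstoD(1))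
    with in_S have "\<forall>\<^sub>F y in at x within S. 0 < \<sigma> * d * (g y - g x)"
    proof eventually_elim
      case (elim y)
      have "0 < (q y * d) * (\<sigma> * (y - x))"
        using elim by (simp only: mult_pos_pos)
      also have "\<dots> = \<sigma> * d * (q y * (y - x))"
        by (simp add: algebra_simps)
      also have "q y * (y - x) = g y - g x"
        using elim by (auto simp: q_def)
      finally show ?case .
    qed
    then have side: "\<forall>\<^sub>F y in at x within S. if \<sigma> * d < 0 then g y < g x else g x < g y"
      by eventually_elim (auto simp: zero_less_mult_iff mult_less_0_iff)
    have "((\<lambda>y. s (g y)) \<longlongrightarrow> (if \<sigma> * d < 0 then hl else hr)) (at x within S)"
    proof (cases "\<sigma> * d < 0")
      case True
      then have "filterlim g (at_left (g x)) (at x within S)"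
        using side cont by (auto simp: filterlim_at elim: eventually_mono)
      with True show ?thesis
        using filterlim_compose[OF sl] by simp
    next
      case False
      then have "filterlim g (at_right (g x)) (at x within S)"
        using side cont by (auto simp: filterlim_at elim: eventually_mono)
      with False show ?thesis
        using filterlim_compose[OF sr] by simp
    qed
    with q show ?thesis
      by (rule tendsto_mult)
  qed
  then show ?thesis
    by (simp add: has_field_derivative_iff sq)
qed

text \<open>At the corner 0 the slopes of \<open>max 0\<close> are 1 on the right and 0 on the left,
  so the one-sided chain rule applies. Only existence of the derivative has to pass through
  Lindley's recursion.\<close>

lemma has_real_derivative_max_0:
  fixes g :: "real \<Rightarrow> real"
  assumes g: "(g has_real_derivative d) (at x within S)"
    and S: "\<And>y. y \<in> S \<Longrightarrow> y \<noteq> x \<Longrightarrow> 0 < \<sigma> * (y - x)"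
  shows "\<exists>D. ((\<lambda>y. max 0 (g y)) has_real_derivative D) (at x within S)"
proof -
  have r: "(max 0 has_real_derivative (if 0 \<le> z then 1 else 0)) (at_right z)" for z :: real
  proof (cases "0 \<le> z")
    case True
    have "((\<lambda>y. y) has_real_derivative 1) (at z within {z..})"
      by (rule DERIV_ident)
    then have "(max 0 has_real_derivative 1) (at z within {z..})"
      by (rule has_field_derivative_transform_within[of _ _ _ _ 1]) (use True in auto)
    then have "(max 0 has_real_derivative 1) (at_right z)"
      by (rule has_field_derivative_subset) auto
    with True show ?thesis by simp
  next
    case False
    have "((\<lambda>y. 0) has_real_derivative 0) (at z)"
      by (rule DERIV_const)
    then have "(max 0 has_real_derivative 0) (at z)"
      by (rule has_field_derivative_transform_within[of _ _ _ _ "- z"])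
         (use False in \<open>auto simp: dist_real_def\<close>)
    with False show ?thesis
      by (simp add: has_field_derivative_at_within)
  qed
  have l: "(max 0 has_real_derivative (if 0 < z then 1 else 0)) (at_left z)" for z :: real
  proof (cases "0 < z")
    case True
    have "((\<lambda>y. y) has_real_derivative 1) (at z)"
      by (rule DERIV_ident)
    then have "(max 0 has_real_derivative 1) (at z)"
      by (rule has_field_derivative_transform_within[of _ _ _ _ z])
         (use True in \<open>auto simp: dist_real_def\<close>)
    with True show ?thesis
      by (simp add: has_field_derivative_at_within)
  next
    case False
    have "((\<lambda>y. 0) has_real_derivative 0) (at z within {..z})"
      by (rule DERIV_const)
    then have "(max 0 has_real_derivative 0) (at z within {..z})"
      by (rule has_field_derivative_transform_within[of _ _ _ _ 1]) (use False in auto)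
    then have "(max 0 has_real_derivative 0) (at_left z)"
      by (rule has_field_derivative_subset) auto
    with False show ?thesis by simp
  qed
  show ?thesis
    using has_real_derivative_one_sided_compose[OF g S r l] by blast
qed

section \<open>Primitives of monotone functions and integrals over a moving window\<close>

definition mono_primitive :: "(real \<Rightarrow> real) \<Rightarrow> real \<Rightarrow> real" where
  "mono_primitive g x = integral {0..x} g - integral {x..0} g"

lemma mono_integrable_on:
  fixes g :: "real \<Rightarrow> real"
  assumes "mono g"
  shows "g integrable_on {a..b}"
  by (rule integrable_on_mono_on) (use assms in \<open>auto simp: mono_on_def mono_def\<close>)

lemma mono_primitive_diff:
  assumes g: "mono g" and "x \<le> y"
  shows "mono_primitive g y - mono_primitive g x = integral {x..y} g"
proof -
  note c = Henstock_Kurzweil_Integration.integral_combine[OF _ _ mono_integrable_on[OF g]]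
  have z: "u > v \<Longrightarrow> integral {u..v} g = 0" for u v
    by simp
  consider "0 \<le> x" | "x < 0" "0 \<le> y" | "y < 0"
    by linarith
  then show ?thesis
  proof cases
    case 1
    then show ?thesis
      using c[of 0 x y] assms by (cases "x = 0"; cases "y = 0") (auto simp: mono_primitive_def)
  next
    case 2
    then show ?thesis
      using c[of x 0 y] by (cases "y = 0") (auto simp: mono_primitive_def)
  next
    case 3
    then show ?thesis
      using c[of x y 0] assms by (auto simp: mono_primitive_def)
  qed
qed

lemma integral_mono_ge:
  assumes g: "mono g" and "x \<le> y"
  shows "(y - x) * g x \<le> integral {x..y} (g :: real \<Rightarrow> real)"
proof -
  have "integral {x..y} (\<lambda>_. g x) \<le> integral {x..y} g"
    by (rule integral_le) (use mono_integrable_on[OF g] monoD[OF g] in auto)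
  with assms show ?thesis by simp
qed

text \<open>The bound is required only strictly below \<open>y\<close>, so that \<open>l\<close> can
  be the left limit at \<open>y\<close> even when \<open>g y\<close> is larger; passing to the open
  interval discards the endpoint.\<close>

lemma integral_mono_le:
  assumes g: "mono g" and "x \<le> y" and l: "\<And>t. t < y \<Longrightarrow> g t \<le> l"
  shows "integral {x..y} (g :: real \<Rightarrow> real) \<le> (y - x) * l"
proof -
  have "integral {x<..<y} g \<le> integral {x<..<y} (\<lambda>_. l)"
    using mono_integrable_on[OF g, of x y] l
    by (intro integral_le) (auto simp: integrable_on_Icc_iff_Ioo[symmetric])
  moreover have "integral {x<..<y} (\<lambda>_. l) = (y - x) * l"
    using \<open>x \<le> y\<close> by (simp add: integral_open_interval_real[symmetric])
  ultimately show ?thesis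
    by (simp add: integral_open_interval_real)
qed

lemma mono_mono_primitive:
  assumes g: "mono g" and nonneg: "\<And>x. 0 \<le> g x"
  shows "mono (mono_primitive g)"
proof (rule monoI)
  fix x y :: real assume "x \<le> y"
  then have "0 \<le> (y - x) * g x"
    using nonneg by simp
  also have "\<dots> \<le> mono_primitive g y - mono_primitive g x"
    using integral_mono_ge[OF g \<open>x \<le> y\<close>] mono_primitive_diff[OF g \<open>x \<le> y\<close>] by simp
  finally show "mono_primitive g x \<le> mono_primitive g y"
    by simp
qed

text \<open>For monotone \<open>g\<close> the mean over [x, y] lies between \<open>g x\<close> and
  \<open>g y\<close>, and the latter tends to \<open>g x\<close>.\<close>

lemma mono_primitive_at_right:
  assumes g: "mono g" and lim: "(g \<longlongrightarrow> g x) (at_right x)"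
  shows "(mono_primitive g has_real_derivative g x) (at_right x)"
  unfolding has_field_derivative_iff
proof (rule tendsto_sandwich[OF _ _ tendsto_const lim])
  have *: "g x \<le> (mono_primitive g y - mono_primitive g x) / (y - x)"
    "(mono_primitive g y - mono_primitive g x) / (y - x) \<le> g y" if "x < y" for y
  proof -
    have "(y - x) * g x \<le> mono_primitive g y - mono_primitive g x"
      "mono_primitive g y - mono_primitive g x \<le> (y - x) * g y"
      using integral_mono_ge[OF g, of x y] integral_mono_le[OF g, of x y "g y"] monoD[OF g]
        mono_primitive_diff[OF g, of x y] that by simp_all
    with that show "g x \<le> (mono_primitive g y - mono_primitive g x) / (y - x)"
      "(mono_primitive g y - mono_primitive g x) / (y - x) \<le> g y"
      by (simp_all add: field_simps)
  qed
  then show "\<forall>\<^sub>F y in at_right x. g x \<le> (mono_primitive g y - mono_primitive g x) / (y - x)"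
    "\<forall>\<^sub>F y in at_right x. (mono_primitive g y - mono_primitive g x) / (y - x) \<le> g y"
    by (auto simp: eventually_at_filter)
qed

lemma mono_at_left_le:
  fixes g :: "real \<Rightarrow> real"
  assumes g: "mono g" and lim: "(g \<longlongrightarrow> l) (at_left x)" and "t < x"
  shows "g t \<le> l"
proof (rule tendsto_lowerbound[OF lim])
  show "\<forall>\<^sub>F y in at_left x. g t \<le> g y"
    using eventually_at_left_real[OF \<open>t < x\<close>] by eventually_elim (use g in \<open>auto intro: monoD\<close>)
qed simp

lemma mono_primitive_at_left:
  assumes g: "mono g" and lim: "(g \<longlongrightarrow> l) (at_left x)"
  shows "(mono_primitive g has_real_derivative l) (at_left x)"
  unfolding has_field_derivative_iff
proof (rule tendsto_sandwich[OF _ _ lim tendsto_const])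
  have *: "g y \<le> (mono_primitive g y - mono_primitive g x) / (y - x)"
    "(mono_primitive g y - mono_primitive g x) / (y - x) \<le> l" if "y < x" for y
  proof -
    have "(x - y) * g y \<le> mono_primitive g x - mono_primitive g y"
      "mono_primitive g x - mono_primitive g y \<le> (x - y) * l"
      using integral_mono_ge[OF g, of y x] integral_mono_le[OF g, of y x l]
        mono_at_left_le[OF g lim] mono_primitive_diff[OF g, of y x] that by simp_all
    with that show "g y \<le> (mono_primitive g y - mono_primitive g x) / (y - x)"
      "(mono_primitive g y - mono_primitive g x) / (y - x) \<le> l"
      by (simp_all add: field_simps)
  qed
  then show "\<forall>\<^sub>F y in at_left x. g y \<le> (mono_primitive g y - mono_primitive g x) / (y - x)"
    "\<forall>\<^sub>F y in at_left x. (mono_primitive g y - mono_primitive g x) / (y - x) \<le> l"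
    by (auto simp: eventually_at_filter)
qed

text \<open>A translation has slope 1, so in the one-sided chain rule the sign of \<sigma> alone
  decides: \<sigma> = 1 selects the right derivative here, \<sigma> = -1 the left one in the next
  lemma.\<close>

lemma mono_primitive_shift_at_right:
  assumes g: "mono g" "(g \<longlongrightarrow> g (x - \<tau>)) (at_right (x - \<tau>))" "(g \<longlongrightarrow> l) (at_left (x - \<tau>))"
  shows "((\<lambda>y. mono_primitive g (y - \<tau>)) has_real_derivative g (x - \<tau>)) (at_right x)"
  using has_real_derivative_one_sided_compose[of "\<lambda>y. y - \<tau>" 1 x "{x<..}" 1 "mono_primitive g"
      "g (x - \<tau>)" l] mono_primitive_at_right[OF g(1,2)] mono_primitive_at_left[OF g(1,3)]
  by (force intro!: derivative_eq_intros)

lemma mono_primitive_shift_at_left: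
  assumes g: "mono g" "(g \<longlongrightarrow> g (x - \<tau>)) (at_right (x - \<tau>))" "(g \<longlongrightarrow> l) (at_left (x - \<tau>))"
  shows "((\<lambda>y. mono_primitive g (y - \<tau>)) has_real_derivative l) (at_left x)"
  using has_real_derivative_one_sided_compose[of "\<lambda>y. y - \<tau>" 1 x "{..<x}" "-1" "mono_primitive g"
      "g (x - \<tau>)" l] mono_primitive_at_right[OF g(1,2)] mono_primitive_at_left[OF g(1,3)]
  by (force intro!: derivative_eq_intros)

text \<open>This is the function \<open>h\<close> of the overview once \<open>g\<close> is the
  truncated cost. Substituting w - u for u gives the integral of \<open>g\<close> over
  [w - \<tau>, w], so \<open>w\<close> enters only through the endpoints of a primitive.\<close>

definition window_integral :: "(real \<Rightarrow> real) \<Rightarrow> real \<Rightarrow> real \<Rightarrow> real" where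
  "window_integral g \<tau> w = mono_primitive g w - mono_primitive g (w - \<tau>)"

lemma nn_integral_window:
  assumes g: "mono g" and nonneg: "\<And>x. 0 \<le> g x" and "0 \<le> \<tau>"
  shows "(\<integral>\<^sup>+u\<in>{0..<\<tau>}. ennreal (g (w - u)) \<partial>lborel) = ennreal (window_integral g \<tau> w)"
proof -
  have [measurable]: "g \<in> borel_measurable borel"
    using g by (rule borel_measurable_mono)
  have "(\<integral>\<^sup>+u\<in>{0..<\<tau>}. ennreal (g (w - u)) \<partial>lborel)
      = (\<integral>\<^sup>+u\<in>{w - \<tau><..w}. ennreal (g u) \<partial>lborel)"
    using nn_integral_real_affine[of "\<lambda>u. ennreal (g u) * indicator {w - \<tau><..w} u" "-1" w]
    by (simp add: indicator_def conj_commute less_diff_eq algebra_simps)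
  also have "\<dots> = (\<integral>\<^sup>+u. ennreal (if u \<in> {w - \<tau>..w} then g u else 0) \<partial>lborel)"
    using AE_lborel_singleton[of "w - \<tau>"]
    by (intro nn_integral_cong_AE) (auto simp: indicator_def elim!: eventually_mono)
  also have "\<dots> = ennreal (integral {w - \<tau>..w} g)"
  proof (rule nn_integral_has_integral_lborel)
    show "((\<lambda>u. if u \<in> {w - \<tau>..w} then g u else 0) has_integral integral {w - \<tau>..w} g) UNIV"
      unfolding has_integral_restrict_UNIV
      using mono_integrable_on[OF g] by (rule integrable_integral)
  qed (use nonneg in auto)
  finally show ?thesis
    using mono_primitive_diff[OF g, of "w - \<tau>" w] \<open>0 \<le> \<tau>\<close> by (simp add: window_integral_def)
qed

lemma window_integral_nonneg:
  assumes g: "mono g" and nonneg: "\<And>x. 0 \<le> g x" and "0 \<le> \<tau>"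
  shows "0 \<le> window_integral g \<tau> w"
proof -
  have "0 \<le> (w - (w - \<tau>)) * g (w - \<tau>)"
    using nonneg \<open>0 \<le> \<tau>\<close> by simp
  also have "\<dots> \<le> window_integral g \<tau> w"
    using integral_mono_ge[OF g, of "w - \<tau>" w] mono_primitive_diff[OF g, of "w - \<tau>" w] \<open>0 \<le> \<tau>\<close>
    by (simp add: window_integral_def)
  finally show ?thesis .
qed

text \<open>The increments of the primitive at the two ends of the window both lie between 0 and
  \<open>(y - x) * g c\<close>, hence so does the absolute value of their difference. Nonnegativity
  of \<open>g\<close> saves a factor 2.\<close>

lemma window_integral_Lipschitz:
  assumes g: "mono g" and nonneg: "\<And>x. 0 \<le> g x" and "0 \<le> \<tau>"
    and "v \<le> c" "w \<le> c"
  shows "\<bar>window_integral g \<tau> w - window_integral g \<tau> v\<bar> \<le> \<bar>w - v\<bar> * g c"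
proof -
  have *: "\<bar>window_integral g \<tau> y - window_integral g \<tau> x\<bar> \<le> (y - x) * g c" if "x \<le> y" "y \<le> c" for x y
  proof -
    have d: "0 \<le> mono_primitive g (y - t) - mono_primitive g (x - t)"
      "mono_primitive g (y - t) - mono_primitive g (x - t) \<le> (y - x) * g c" if "0 \<le> t" for t
    proof -
      have "0 \<le> (y - x) * g (x - t)"
        using nonneg \<open>x \<le> y\<close> by simp
      moreover have "z < y - t \<Longrightarrow> g z \<le> g c" for z
        using \<open>0 \<le> t\<close> \<open>y \<le> c\<close> by (intro monoD[OF g]) simp
      ultimately show "0 \<le> mono_primitive g (y - t) - mono_primitive g (x - t)"
        "mono_primitive g (y - t) - mono_primitive g (x - t) \<le> (y - x) * g c"
        using integral_mono_ge[OF g, of "x - t" "y - t"] integral_mono_le[OF g, of "x - t" "y - t" "g c"]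
          mono_primitive_diff[OF g, of "x - t" "y - t"] \<open>x \<le> y\<close> by simp_all
    qed
    show ?thesis
      using d[of 0] d[OF \<open>0 \<le> \<tau>\<close>] by (simp add: window_integral_def abs_if)
  qed
  show ?thesis
    using *[of v w] *[of w v] assms(4,5) abs_minus_commute[of "window_integral g \<tau> w"]
    by (cases "v \<le> w") auto
qed

text \<open>The intervals (x - 1/n, x] have mass f(x) - f(x - 1/n) and decrease to {x}. The result
  turns left limits of \<open>f\<close> into the atoms that occur in the formula.\<close>

lemma interval_measure_singleton_at_left:
  assumes f: "mono f" and cadlag: "cadlag f"
  shows "(f \<longlongrightarrow> f x - measure (interval_measure f) {x}) (at_left x)"
proof -
  obtain l where l: "(f \<longlongrightarrow> l) (at_left x)"
    using cadlag by (auto simp: cadlag_def)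
  have Ioc: "emeasure (interval_measure f) {u<..v} = ennreal (f v - f u)" if "u \<le> v" for u v
    using that f cadlag by (intro emeasure_interval_measure_Ioc) (auto simp: cadlag_def mono_def)
  define A where "A n = {x - 1 / real (Suc n)<..x}" for n
  have "(\<lambda>n. measure (interval_measure f) (A n)) \<longlonglongrightarrow> measure (interval_measure f) (\<Inter>n. A n)"
  proof (rule Lim_measure_decseq)
    show "range A \<subseteq> sets (interval_measure f)"
      by (auto simp: A_def)
    show "decseq A"
    proof (rule decseq_SucI)
      fix n
      have "1 / real (Suc (Suc n)) \<le> 1 / real (Suc n)"
        by (simp add: field_simps)
      then show "A (Suc n) \<subseteq> A n"
        by (force simp: A_def)
    qed
    show "emeasure (interval_measure f) (A n) \<noteq> \<infinity>" for n
      using Ioc[of "x - 1 / real (Suc n)" x] by (simp add: A_def)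
  qed
  moreover have "(\<Inter>n. A n) = {x}"
  proof -
    have "y = x" if lower: "\<And>n. x - 1 / real (Suc n) < y" and "y \<le> x" for y
    proof (rule ccontr)
      assume "y \<noteq> x"
      then obtain n where "1 / real (Suc n) < x - y"
        using reals_Archimedean[of "x - y"] \<open>y \<le> x\<close> by (auto simp: inverse_eq_divide)
      with lower[of n] show False by linarith
    qed
    then show ?thesis by (auto simp: A_def)
  qed
  moreover have "measure (interval_measure f) (A n) = f x - f (x - 1 / real (Suc n))" for n
    using Ioc[of "x - 1 / real (Suc n)" x] f by (simp add: A_def measure_def mono_def)
  ultimately have "(\<lambda>n. f x - f (x - 1 / real (Suc n))) \<longlonglongrightarrow> measure (interval_measure f) {x}"
    by simp
  moreover have "(\<lambda>n. f x - f (x - 1 / real (Suc n))) \<longlonglongrightarrow> f x - l"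
  proof -
    have "(\<lambda>n. x - 1 / real (Suc n)) \<longlonglongrightarrow> x - 0"
      by (intro tendsto_diff tendsto_const LIMSEQ_Suc lim_1_over_n)
    then have "filterlim (\<lambda>n. x - 1 / real (Suc n)) (at_left x) sequentially"
      by (auto simp: filterlim_at)
    from tendsto_diff[OF tendsto_const filterlim_compose[OF l this]] show ?thesis .
  qed
  ultimately have "measure (interval_measure f) {x} = f x - l"
    by (rule LIMSEQ_unique)
  with l show ?thesis by simp
qed

text \<open>Composition with \<open>max 0\<close> absorbs the reflection of the workload, so the
  cost can be evaluated at w - u without a positive part. Subtracting \<open>f 0\<close> makes it
  nonnegative, as the inversion formula in \<open>ennreal\<close> and the Lipschitz bound
  require.\<close>

definition truncate_at_0 :: "(real \<Rightarrow> real) \<Rightarrow> real \<Rightarrow> real" where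
  "truncate_at_0 f x = f (max 0 x) - f 0"

lemma mono_truncate_at_0: "mono f \<Longrightarrow> mono (truncate_at_0 f)"
  unfolding truncate_at_0_def by (intro monoI diff_right_mono) (auto elim!: monoD)

lemma truncate_at_0_nonneg: "mono f \<Longrightarrow> 0 \<le> truncate_at_0 f x"
  by (simp add: truncate_at_0_def monoD)

lemma truncate_at_0_at_right:
  assumes "cadlag f"
  shows "(truncate_at_0 f \<longlongrightarrow> truncate_at_0 f x) (at_right x)"
proof (cases "0 \<le> x")
  case True
  have "(f \<longlongrightarrow> f x) (at_right x)"
    using assms by (simp add: cadlag_def continuous_within)
  then have "((\<lambda>y. f y - f 0) \<longlongrightarrow> f x - f 0) (at_right x)"
    by (intro tendsto_intros)
  moreover have "\<forall>\<^sub>F y in at_right x. f y - f 0 = truncate_at_0 f y"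
    using True by (auto simp: eventually_at_filter truncate_at_0_def)
  ultimately show ?thesis
    using True by (simp add: truncate_at_0_def[of f x] Lim_transform_eventually)
next
  case False
  then have "x < 0" by simp
  have "\<forall>\<^sub>F y in at_right x. 0 = truncate_at_0 f y"
    using eventually_at_right_real[OF \<open>x < 0\<close>] by eventually_elim (simp add: truncate_at_0_def)
  then show ?thesis
    using False by (simp add: truncate_at_0_def[of f x] Lim_transform_eventually[OF tendsto_const])
qed

lemma truncate_at_0_at_left:
  assumes f: "mono f" and cadlag: "cadlag f" and f0: "(f \<longlongrightarrow> f 0) (at_left 0)"
  shows "(truncate_at_0 f
      \<longlongrightarrow> truncate_at_0 f x - measure (interval_measure f) {max 0 x}) (at_left x)"
proof (cases "0 < x")
  case True
  have "((\<lambda>y. f y - f 0) \<longlongrightarrow> f x - measure (interval_measure f) {x} - f 0) (at_left x)"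
    by (intro tendsto_intros interval_measure_singleton_at_left f cadlag)
  moreover have "\<forall>\<^sub>F y in at_left x. f y - f 0 = truncate_at_0 f y"
    using eventually_at_left_real[OF True] by eventually_elim (simp add: truncate_at_0_def)
  ultimately show ?thesis
    using True by (simp add: truncate_at_0_def[of f x] Lim_transform_eventually algebra_simps)
next
  case False
  \<comment> \<open>To the left of a nonpositive point the truncated function is constantly 0, so
    the atom subtracted at 0 has to vanish; this is where left continuity of \<open>f\<close> at 0
    enters.\<close>
  have "f 0 - measure (interval_measure f) {0} = f 0"
    using tendsto_unique[OF _ interval_measure_singleton_at_left[OF f cadlag] f0] by simp
  moreover have "\<forall>\<^sub>F y in at_left x. 0 = truncate_at_0 f y"
    using False by (auto simp: eventually_at_filter truncate_at_0_def)
  ultimately show ?thesis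
    using False by (simp add: truncate_at_0_def[of f x] Lim_transform_eventually[OF tendsto_const])
qed

section \<open>Workload and cycles\<close>

lemma left_lim_eq:
  assumes "(g \<longlongrightarrow> l) (at_left t)"
  shows "left_lim g t = l"
  unfolding left_lim_def by (rule tendsto_Lim[OF _ assms]) simp

lemma cadlag_left_lim:
  assumes "cadlag g"
  shows "(g \<longlongrightarrow> left_lim g t) (at_left t)"
  using assms left_lim_eq unfolding cadlag_def by metis

lemma left_lim_shift:
  assumes "cadlag g"
  shows "left_lim (\<lambda>s. g (s + t)) x = left_lim g (x + t)"
proof (rule left_lim_eq)
  have "((\<lambda>s. s + t) \<longlongrightarrow> x + t) (at_left x)"
    by (intro tendsto_intros)
  then have "filterlim (\<lambda>s. s + t) (at_left (x + t)) (at_left x)"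
    by (auto simp: filterlim_at eventually_at_filter)
  with cadlag_left_lim[OF assms] show "((\<lambda>s. g (s + t)) \<longlongrightarrow> left_lim g (x + t)) (at_left x)"
    by (rule filterlim_compose)
qed

context stationary_arrivals
begin

lemma stationary_workloadD:
  assumes "stationary_workload M flow T S V"
  shows "V t \<in> borel_measurable M"
    and "\<omega> \<in> space M \<Longrightarrow> cadlag (\<lambda>t. V t \<omega>)"
    and "\<omega> \<in> space M \<Longrightarrow> V t \<omega> = V 0 (flow t \<omega>)"
    and "\<omega> \<in> space M \<Longrightarrow> T n \<omega> \<le> t \<Longrightarrow> t < T (n + 1) \<omega> \<Longrightarrow>
      V t \<omega> = max 0 (left_lim (\<lambda>s. V s \<omega>) (T n \<omega>) + S n \<omega> - (t - T n \<omega>))"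
  using assms unfolding stationary_workload_def by (blast, blast, blast, meson atLeastLessThan_iff)

lemmas workload_eq = stationary_workloadD(4)

lemma workload_flow:
  assumes V: "stationary_workload M flow T S V" and \<omega>: "\<omega> \<in> space M"
  shows "V s (flow t \<omega>) = V (s + t) \<omega>"
proof -
  have *: "V r \<omega>' = V 0 (flow r \<omega>')" if "\<omega>' \<in> space M" for r \<omega>'
    using stationary_workloadD(3)[OF V that] .
  show ?thesis
    using *[OF \<omega>, of "s + t"] *[OF flow_space[OF \<omega>, of t], of s] flow_add[OF \<omega>, of s t] by simp
qed

lemma workload_left_lim_flow:
  assumes V: "stationary_workload M flow T S V" and \<omega>: "\<omega> \<in> space M"
  shows "left_lim (\<lambda>s. V s (flow t \<omega>)) x = left_lim (\<lambda>s. V s \<omega>) (x + t)"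
  using left_lim_shift[OF stationary_workloadD(2)[OF V \<omega>], of t x]
  by (simp add: workload_flow[OF V \<omega>])

text \<open>The left limit is a sequential limit along
  \<open>T n \<omega> - 1 / real (Suc m)\<close>. The workload at such a random time is
  \<open>V 0\<close> at a point moved by the flow, so measurability comes from \<open>V 0\<close>
  and the joint measurability of the flow.\<close>

lemma measurable_workload_left_lim:
  assumes V: "stationary_workload M flow T S V"
  shows "(\<lambda>\<omega>. left_lim (\<lambda>s. V s \<omega>) (T n \<omega>)) \<in> borel_measurable M"
proof (rule borel_measurable_LIMSEQ_real)
  fix \<omega> assume \<omega>: "\<omega> \<in> space M"
  have "(\<lambda>m. T n \<omega> - 1 / real (Suc m)) \<longlonglongrightarrow> T n \<omega> - 0"
    by (intro tendsto_diff tendsto_const LIMSEQ_Suc lim_1_over_n)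
  then have "filterlim (\<lambda>m. T n \<omega> - 1 / real (Suc m)) (at_left (T n \<omega>)) sequentially"
    by (auto simp: filterlim_at)
  moreover have "((\<lambda>s. V s \<omega>) \<longlongrightarrow> left_lim (\<lambda>s. V s \<omega>) (T n \<omega>)) (at_left (T n \<omega>))"
    by (rule cadlag_left_lim[OF stationary_workloadD(2)[OF V \<omega>]])
  ultimately have "(\<lambda>m. V (T n \<omega> - 1 / real (Suc m)) \<omega>) \<longlonglongrightarrow> left_lim (\<lambda>s. V s \<omega>) (T n \<omega>)"
    by (rule filterlim_compose[rotated])
  then show "(\<lambda>m. V 0 (flow (T n \<omega> - 1 / real (Suc m)) \<omega>)) \<longlonglongrightarrow> left_lim (\<lambda>s. V s \<omega>) (T n \<omega>)"
    by (simp add: workload_flow[OF V \<omega>])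
next
  fix m
  have [measurable]: "V 0 \<in> borel_measurable M"
    by (rule stationary_workloadD(1)[OF V])
  have [measurable]: "(\<lambda>\<omega>. flow (T n \<omega> - 1 / real (Suc m)) \<omega>) \<in> measurable M M"
    by (rule measurable_flow_random) auto
  show "(\<lambda>\<omega>. V 0 (flow (T n \<omega> - 1 / real (Suc m)) \<omega>)) \<in> borel_measurable M"
    by measurable
qed

text \<open>Lindley's recursion: the path formula on [\<open>T n\<close>, \<open>T (n + 1)\<close>)
  is continuous in time and extends to the right end as a left limit.\<close>

lemma workload_step:
  assumes V: "stationary_workload M flow T S V" and \<omega>: "\<omega> \<in> space M"
  shows "left_lim (\<lambda>s. V s \<omega>) (T (n + 1) \<omega>)
    = max 0 (left_lim (\<lambda>s. V s \<omega>) (T n \<omega>) + S n \<omega> - (T (n + 1) \<omega> - T n \<omega>))"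
proof (rule left_lim_eq)
  let ?c = "left_lim (\<lambda>s. V s \<omega>) (T n \<omega>) + S n \<omega>"
  have "T n \<omega> < T (n + 1) \<omega>"
    using strict_monoD[OF T_simple[OF \<omega>]] by simp
  from eventually_at_left_real[OF this]
  have "\<forall>\<^sub>F t in at_left (T (n + 1) \<omega>). max 0 (?c - (t - T n \<omega>)) = V t \<omega>"
    by eventually_elim (simp add: workload_eq[OF V \<omega>, of n])
  moreover have "((\<lambda>t. max 0 (?c - (t - T n \<omega>))) \<longlongrightarrow> max 0 (?c - (T (n + 1) \<omega> - T n \<omega>)))
      (at_left (T (n + 1) \<omega>))"
    by (intro tendsto_intros)
  ultimately show "((\<lambda>s. V s \<omega>) \<longlongrightarrow> max 0 (?c - (T (n + 1) \<omega> - T n \<omega>))) (at_left (T (n + 1) \<omega>))"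
    by (rule Lim_transform_eventually[rotated])
qed

lemma workload_origin:
  assumes V: "stationary_workload M flow T S V" and \<omega>: "\<omega> \<in> space M"
  shows "V 0 \<omega> = max 0 (left_lim (\<lambda>s. V s \<omega>) (T 0 \<omega>) + S 0 \<omega> + T 0 \<omega>)"
  using workload_eq[OF V \<omega>, of 0 0] T_origin[OF \<omega>] by simp

lemma workload_nonneg:
  assumes "stationary_workload M flow T S V" "\<omega> \<in> space M"
  shows "0 \<le> V 0 \<omega>"
  using workload_origin[OF assms] by simp

lemma workload_decreases:
  assumes V: "stationary_workload M flow T S V" and \<omega>: "\<omega> \<in> space M"
    and t: "0 \<le> t" "t < T 1 \<omega>"
  shows "V t \<omega> = max 0 (V 0 \<omega> - t)"
  using workload_eq[OF V \<omega>, of 0 t] workload_origin[OF V \<omega>] T_origin[OF \<omega>] t by simp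

lemma workload_before_next_arrival:
  assumes V: "stationary_workload M flow T S V" and \<omega>: "\<omega> \<in> space M"
  shows "left_lim (\<lambda>s. V s \<omega>) (T 1 \<omega>) = max 0 (V 0 \<omega> - T 1 \<omega>)"
  using workload_step[OF V \<omega>, of 0] workload_origin[OF V \<omega>] T_origin[OF \<omega>] by (simp add: max_def)

end

section \<open>Cycles of the starred system\<close>

context gg1_queue
begin

definition start :: "int \<Rightarrow> 'a \<Rightarrow> bool" where
  "start n \<omega> \<longleftrightarrow> left_lim (\<lambda>s. Wstar s \<omega>) (T n \<omega>) = 0"

text \<open>The cycle [\<open>R 0\<close>, \<open>R 1\<close>) in terms of arrival indices. The
  times \<open>R\<close> are given only through their range for each \<omega>, whereas
  \<open>start\<close> transforms explicitly when the origin moves to an arrival.\<close>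

definition busy_cycle :: "'a \<Rightarrow> int \<Rightarrow> int \<Rightarrow> bool" where
  "busy_cycle \<omega> i j \<longleftrightarrow> i \<le> 0 \<and> 0 < j \<and> start i \<omega> \<and> start j \<omega> \<and> (\<forall>k. i < k \<longrightarrow> k < j \<longrightarrow> \<not> start k \<omega>)"

definition cycle_length :: "'a \<Rightarrow> real" where
  "cycle_length \<omega> = measure (arrivals T \<omega>) {R 0 \<omega>..<R 1 \<omega>}"

lemma measurable_start [measurable]: "Measurable.pred M (start n)"
  unfolding start_def using measurable_workload_left_lim[OF Wstar_workload] by measurable

lemma start_flow:
  assumes "\<omega> \<in> space M"
  shows "start k (flow (T n \<omega>) \<omega>) \<longleftrightarrow> start (k + n) \<omega>"
  using assms
  by (simp add: start_def workload_left_lim_flow[OF Wstar_workload] T_flow_arrival)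

lemma xi_flow:
  assumes "\<omega> \<in> space M"
  shows "\<xi> k (flow (T n \<omega>) \<omega>) = \<xi> (k + n) \<omega>"
  using assms xi_compatible[of "flow (T n \<omega>) \<omega>" k] xi_compatible[of \<omega> "k + n"]
  by (simp add: T_flow_arrival flow_add)

lemma cycle_unique:
  assumes "busy_cycle \<omega> i j" "busy_cycle \<omega> i' j'"
  shows "i = i'" "j = j'"
proof -
  have "\<not> i < i'" "\<not> i' < i" "\<not> j < j'" "\<not> j' < j"
    using assms unfolding busy_cycle_def by force+
  then show "i = i'" "j = j'"
    by auto
qed

text \<open>The condition \<open>i \<le> n\<close>, \<open>n < j\<close> says that arrival
  \<open>n\<close> belongs to the cycle, so a shift there merely renumbers it.\<close>

lemma cycle_flow:
  assumes \<omega>: "\<omega> \<in> space M" and "busy_cycle \<omega> i j" "i \<le> n" "n < j"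
  shows "busy_cycle (flow (T n \<omega>) \<omega>) (i - n) (j - n)"
  using assms(2-) by (auto simp: busy_cycle_def start_flow[OF \<omega>])

lemma cycle_exists:
  assumes \<omega>: "\<omega> \<in> space M"
  obtains i j where "busy_cycle \<omega> i j" "R 0 \<omega> = T i \<omega>" "R 1 \<omega> = T j \<omega>"
proof -
  have r: "range (\<lambda>k. R k \<omega>) = {T n \<omega> | n. start n \<omega>}"
    using R_range[OF \<omega>] by (simp add: start_def)
  obtain i where i: "R 0 \<omega> = T i \<omega>" "start i \<omega>"
    using r by blast
  obtain j where j: "R 1 \<omega> = T j \<omega>" "start j \<omega>"
    using r by blast
  note T_less = strict_mono_less[OF T_simple[OF \<omega>]]
  have "T i \<omega> < T 1 \<omega>" "T 0 \<omega> < T j \<omega>"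
    using R_origin[OF \<omega>] T_origin[OF \<omega>] i j by linarith+
  then have "i \<le> 0" "0 < j"
    using T_less by fastforce+
  moreover have "\<not> start k \<omega>" if "i < k" "k < j" for k
  proof
    assume "start k \<omega>"
    then obtain m where "T k \<omega> = R m \<omega>"
      using r by blast
    then have "R 0 \<omega> < R m \<omega>" "R m \<omega> < R 1 \<omega>"
      using that i(1) j(1) T_less[of i k] T_less[of k j] by simp_all
    then have "0 < m" "m < 1"
      using strict_mono_less[OF R_strict_mono[OF \<omega>]] by blast+
    then show False by simp
  qed
  ultimately show thesis
    using i j that by (auto simp: busy_cycle_def)
qed

lemma cycle_length:
  assumes \<omega>: "\<omega> \<in> space M" and c: "busy_cycle \<omega> i j"
  shows "cycle_length \<omega> = real_of_int (j - i)"
proof -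
  obtain i' j' where c': "busy_cycle \<omega> i' j'" "R 0 \<omega> = T i' \<omega>" "R 1 \<omega> = T j' \<omega>"
    using cycle_exists[OF \<omega>] .
  with cycle_unique[OF c c'(1)] have "R 0 \<omega> = T i \<omega>" "R 1 \<omega> = T j \<omega>"
    by auto
  then show ?thesis
    using measure_arrivals_Ico[OF \<omega>, of i j] c by (simp add: cycle_length_def busy_cycle_def)
qed

text \<open>All arrivals of a cycle see the same cycle length; this allows the length to be used as
  a common factor after moving the origin within the cycle.\<close>

lemma cycle_length_flow:
  assumes \<omega>: "\<omega> \<in> space M" and c: "busy_cycle \<omega> i j" "i \<le> n" "n < j"
  shows "cycle_length (flow (T n \<omega>) \<omega>) = cycle_length \<omega>"
  using cycle_length[OF \<omega> c(1)] cycle_length[OF flow_space[OF \<omega>] cycle_flow[OF \<omega> c]] by simp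

lemma workload_at_cycle_start:
  assumes \<theta>: "\<theta> \<in> \<Theta>" and \<omega>: "\<omega> \<in> space M" and c: "busy_cycle \<omega> i j"
  shows "left_lim (\<lambda>s. W \<theta> s \<omega>) (T i \<omega>) = 0"
proof -
  obtain i' j' where c': "busy_cycle \<omega> i' j'" "R 0 \<omega> = T i' \<omega>"
    using cycle_exists[OF \<omega>] .
  with cycle_unique[OF c c'(1)] W_starts_at_R[OF \<theta> \<omega>, of 0] show ?thesis
    by simp
qed

lemma distribution_bounds:
  assumes "\<theta> \<in> \<Theta>"
  shows "0 \<le> F x \<theta>" "F x \<theta> \<le> 1"
proof -
  interpret P0: prob_space P0
    by (rule palm_prob_space)
  have "service F \<xi> \<theta> 0 \<in> borel_measurable P0"
    using service_indep[OF assms] by (simp add: P0.indep_vars_def)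
  then interpret service_law: prob_space "distr P0 borel (service F \<xi> \<theta> 0)"
    by (rule P0.prob_space_distr)
  show "0 \<le> F x \<theta>" "F x \<theta> \<le> 1"
    using service_cdf[OF assms, of x 0] service_law.prob_le_1 by (simp_all add: cdf_def)
qed

text \<open>The junk values of the quantile function outside \<open>[0, 1)\<close> do not depend on the parameter.\<close>

lemma quantile_outside:
  assumes "u \<notin> {0..<1}" "\<theta> \<in> \<Theta>" "\<theta>' \<in> \<Theta>"
  shows "quantile F u \<theta> = quantile F u \<theta>'"
proof -
  have "F x \<theta> \<le> u \<longleftrightarrow> F x \<theta>' \<le> u" for x
    using assms distribution_bounds[of \<theta> x] distribution_bounds[of \<theta>' x] by fastforce
  then show ?thesis
    by (simp add: quantile_def)
qed

end

section \<open>Derivatives with respect to the parameter\<close>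

locale differentiable_queue = gg1_queue M flow T P0 "{a..b}" F \<xi> W Wstar R
  for M :: "'a measure" and flow T P0 and a b :: real and F \<xi> W Wstar R +
  fixes f K :: "real \<Rightarrow> real"
  assumes f_mono: "mono f"
    and f_cadlag: "cadlag f"
    and f_left_0: "(f \<longlongrightarrow> f 0) (at_left 0)"
    and J_finite: "\<And>\<theta>. \<theta> \<in> {a..b} \<Longrightarrow> integrable M (\<lambda>\<omega>. f (W \<theta> 0 \<omega>))"
    and G_differentiable:
      "\<And>u \<theta>. u \<in> {0..<1} \<Longrightarrow> \<theta> \<in> {a..b} \<Longrightarrow> quantile F u differentiable (at \<theta> within {a..b})"
    and G_Lipschitz:
      "\<And>u \<theta>1 \<theta>2. u \<in> {0..<1} \<Longrightarrow> \<theta>1 \<in> {a..b} \<Longrightarrow> \<theta>2 \<in> {a..b} \<Longrightarrow>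
         \<bar>quantile F u \<theta>1 - quantile F u \<theta>2\<bar> \<le> K u * \<bar>\<theta>1 - \<theta>2\<bar>"
    and K_moment: "integrable P0 (\<lambda>\<omega>. K (\<xi> 0 \<omega>) ^ 4)"
    and cycle_moment: "integrable P0 (\<lambda>\<omega>. measure (arrivals T \<omega>) {R 0 \<omega>..<R 1 \<omega>} ^ 4)"
    and f_moment: "integrable P0 (\<lambda>\<omega>. f (Wstar 0 \<omega>) ^ 2)"
begin

text \<open>The case of a mark outside [0, 1), where the service time is constant in the parameter,
  makes this valid for every \<omega> rather than almost surely.\<close>

lemma service_differentiable:
  assumes "\<theta> \<in> {a..b}"
  shows "\<exists>d. ((\<lambda>\<phi>. service F \<xi> \<phi> n \<omega>) has_real_derivative d) (at \<theta> within {a..b})"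
proof (cases "\<xi> n \<omega> \<in> {0..<1}")
  case True
  then show ?thesis
    using G_differentiable[OF True assms] by (simp add: real_differentiable_def service_def)
next
  case False
  have "((\<lambda>_. service F \<xi> \<theta> n \<omega>) has_real_derivative 0) (at \<theta> within {a..b})"
    by (rule DERIV_const)
  then have "((\<lambda>\<phi>. service F \<xi> \<phi> n \<omega>) has_real_derivative 0) (at \<theta> within {a..b})"
    by (rule has_field_derivative_transform_within[OF _ zero_less_one assms])
       (unfold service_def, rule quantile_outside[OF False assms])
  then show ?thesis ..
qed

text \<open>The absolute value on \<open>K\<close> is there because a mark outside [0, 1) may carry
  a negative value of \<open>K\<close>.\<close>

lemma service_Lipschitz:
  assumes "\<theta> \<in> {a..b}" "\<phi> \<in> {a..b}"
  shows "\<bar>service F \<xi> \<phi> n \<omega> - service F \<xi> \<theta> n \<omega>\<bar> \<le> \<bar>K (\<xi> n \<omega>)\<bar> * \<bar>\<phi> - \<theta>\<bar>"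
proof (cases "\<xi> n \<omega> \<in> {0..<1}")
  case True
  have "\<bar>service F \<xi> \<phi> n \<omega> - service F \<xi> \<theta> n \<omega>\<bar> \<le> K (\<xi> n \<omega>) * \<bar>\<phi> - \<theta>\<bar>"
    using G_Lipschitz[OF True assms(2,1)] by (simp add: service_def)
  also have "\<dots> \<le> \<bar>K (\<xi> n \<omega>)\<bar> * \<bar>\<phi> - \<theta>\<bar>"
    by (intro mult_right_mono) auto
  finally show ?thesis .
next
  case False
  then show ?thesis
    by (simp add: service_def quantile_outside[OF False assms(2,1)])
qed

section \<open>Regularity of the workload in the parameter\<close>

context
  fixes \<theta> \<sigma> :: real and S :: "real set"
  assumes S: "S \<subseteq> {a..b}" "\<theta> \<in> S"
    and side: "\<And>\<phi>. \<phi> \<in> S \<Longrightarrow> \<phi> \<noteq> \<theta> \<Longrightarrow> 0 < \<sigma> * (\<phi> - \<theta>)"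
begin

text \<open>Induction along Lindley's recursion from the start of the cycle. Since cycles are those
  of the starred system, the starting index is the same for all parameters, and the workload found
  there is constantly 0.\<close>

lemma workload_left_lim_differentiable:
  assumes \<omega>: "\<omega> \<in> space M" and c: "busy_cycle \<omega> i j" and "i \<le> n"
  shows "\<exists>d. ((\<lambda>\<phi>. left_lim (\<lambda>s. W \<phi> s \<omega>) (T n \<omega>)) has_real_derivative d) (at \<theta> within S)"
  using \<open>i \<le> n\<close>
proof (induction n rule: int_ge_induct)
  case base
  have "((\<lambda>_. 0) has_real_derivative 0) (at \<theta> within S)"
    by (rule DERIV_const)
  then have "((\<lambda>\<phi>. left_lim (\<lambda>s. W \<phi> s \<omega>) (T i \<omega>)) has_real_derivative 0) (at \<theta> within S)"
    by (rule has_field_derivative_transform_within[OF _ zero_less_one S(2)])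
       (use S workload_at_cycle_start[OF _ \<omega> c] in auto)
  then show ?case ..
next
  case (step n)
  obtain d where d: "((\<lambda>\<phi>. left_lim (\<lambda>s. W \<phi> s \<omega>) (T n \<omega>)) has_real_derivative d) (at \<theta> within S)"
    using step by blast
  obtain e where e: "((\<lambda>\<phi>. service F \<xi> \<phi> n \<omega>) has_real_derivative e) (at \<theta> within S)"
    using service_differentiable[of \<theta> n \<omega>] S has_field_derivative_subset by blast
  let ?g = "\<lambda>\<phi>. left_lim (\<lambda>s. W \<phi> s \<omega>) (T n \<omega>) + service F \<xi> \<phi> n \<omega> - (T (n + 1) \<omega> - T n \<omega>)"
  have "(?g has_real_derivative d + e - 0) (at \<theta> within S)"
    by (intro derivative_intros d e)
  then obtain D where "((\<lambda>\<phi>. max 0 (?g \<phi>)) has_real_derivative D) (at \<theta> within S)"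
    using has_real_derivative_max_0[OF _ side] by blast
  then have "((\<lambda>\<phi>. left_lim (\<lambda>s. W \<phi> s \<omega>) (T (n + 1) \<omega>)) has_real_derivative D) (at \<theta> within S)"
    by (rule has_field_derivative_transform_within[OF _ zero_less_one S(2)])
       (use S workload_step[OF W_workload \<omega>] in auto)
  then show ?case ..
qed

lemma workload_differentiable:
  assumes \<omega>: "\<omega> \<in> space M"
  shows "\<exists>d. ((\<lambda>\<phi>. W \<phi> 0 \<omega>) has_real_derivative d) (at \<theta> within S)"
proof -
  obtain i j where c: "busy_cycle \<omega> i j"
    using cycle_exists[OF \<omega>] .
  then have "i \<le> 0"
    by (simp add: busy_cycle_def)
  with c obtain d where
    d: "((\<lambda>\<phi>. left_lim (\<lambda>s. W \<phi> s \<omega>) (T 0 \<omega>)) has_real_derivative d) (at \<theta> within S)"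
    using workload_left_lim_differentiable[OF \<omega>] by blast
  obtain e where e: "((\<lambda>\<phi>. service F \<xi> \<phi> 0 \<omega>) has_real_derivative e) (at \<theta> within S)"
    using service_differentiable[of \<theta> 0 \<omega>] S has_field_derivative_subset by blast
  let ?g = "\<lambda>\<phi>. left_lim (\<lambda>s. W \<phi> s \<omega>) (T 0 \<omega>) + service F \<xi> \<phi> 0 \<omega> + T 0 \<omega>"
  have "(?g has_real_derivative d + e + 0) (at \<theta> within S)"
    by (intro derivative_intros d e)
  then obtain D where "((\<lambda>\<phi>. max 0 (?g \<phi>)) has_real_derivative D) (at \<theta> within S)"
    using has_real_derivative_max_0[OF _ side] by blast
  then have "((\<lambda>\<phi>. W \<phi> 0 \<omega>) has_real_derivative D) (at \<theta> within S)"
    by (rule has_field_derivative_transform_within[OF _ zero_less_one S(2)])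
       (use S workload_origin[OF W_workload \<omega>] in auto)
  then show ?thesis ..
qed

end

text \<open>As \<open>max 0\<close> does not increase distances, each arrival since the start of the
  cycle adds only the Lipschitz constant of its own service time.\<close>

lemma workload_left_lim_Lipschitz:
  assumes \<omega>: "\<omega> \<in> space M" and c: "busy_cycle \<omega> i j" and "i \<le> n"
    and \<theta>: "\<theta> \<in> {a..b}" and \<phi>: "\<phi> \<in> {a..b}"
  shows "\<bar>left_lim (\<lambda>s. W \<phi> s \<omega>) (T n \<omega>) - left_lim (\<lambda>s. W \<theta> s \<omega>) (T n \<omega>)\<bar>
    \<le> (\<Sum>k\<in>{i..<n}. \<bar>K (\<xi> k \<omega>)\<bar>) * \<bar>\<phi> - \<theta>\<bar>"
  using \<open>i \<le> n\<close>
proof (induction n rule: int_ge_induct)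
  case base
  then show ?case
    by (simp add: workload_at_cycle_start[OF \<theta> \<omega> c] workload_at_cycle_start[OF \<phi> \<omega> c])
next
  case (step n)
  have "{i..<n + 1} = insert n {i..<n}"
    using step by auto
  then have "(\<Sum>k\<in>{i..<n + 1}. \<bar>K (\<xi> k \<omega>)\<bar>) * \<bar>\<phi> - \<theta>\<bar>
      = \<bar>K (\<xi> n \<omega>)\<bar> * \<bar>\<phi> - \<theta>\<bar> + (\<Sum>k\<in>{i..<n}. \<bar>K (\<xi> k \<omega>)\<bar>) * \<bar>\<phi> - \<theta>\<bar>"
    by (simp add: distrib_right)
  with step.IH service_Lipschitz[OF \<theta> \<phi>, of n \<omega>] show ?case
    unfolding workload_step[OF W_workload[OF \<theta>] \<omega>] workload_step[OF W_workload[OF \<phi>] \<omega>]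
    by linarith
qed

lemma workload_Lipschitz:
  assumes \<omega>: "\<omega> \<in> space M" and c: "busy_cycle \<omega> i j"
    and \<theta>: "\<theta> \<in> {a..b}" and \<phi>: "\<phi> \<in> {a..b}"
  shows "\<bar>W \<phi> 0 \<omega> - W \<theta> 0 \<omega>\<bar> \<le> (\<Sum>k\<in>{i..0}. \<bar>K (\<xi> k \<omega>)\<bar>) * \<bar>\<phi> - \<theta>\<bar>"
proof -
  have "i \<le> 0"
    using c by (simp add: busy_cycle_def)
  then have "{i..0} = insert 0 {i..<0}"
    by auto
  then have "(\<Sum>k\<in>{i..0}. \<bar>K (\<xi> k \<omega>)\<bar>) * \<bar>\<phi> - \<theta>\<bar>
      = \<bar>K (\<xi> 0 \<omega>)\<bar> * \<bar>\<phi> - \<theta>\<bar> + (\<Sum>k\<in>{i..<0}. \<bar>K (\<xi> k \<omega>)\<bar>) * \<bar>\<phi> - \<theta>\<bar>"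
    by (simp add: distrib_right)
  with workload_left_lim_Lipschitz[OF \<omega> c \<open>i \<le> 0\<close> \<theta> \<phi>] service_Lipschitz[OF \<theta> \<phi>, of 0 \<omega>]
  show ?thesis
    unfolding workload_origin[OF W_workload[OF \<theta>] \<omega>] workload_origin[OF W_workload[OF \<phi>] \<omega>]
    by linarith
qed

section \<open>Second moment of the Lipschitz constant over a cycle\<close>

lemma measurable_cycle_length [measurable]: "cycle_length \<in> borel_measurable M"
proof -
  have "(\<lambda>\<omega>. cycle_length \<omega> ^ 4) \<in> borel_measurable M"
    using borel_measurable_integrable[OF cycle_moment]
    by (simp add: cycle_length_def cong: measurable_cong_sets)
  then have "(\<lambda>\<omega>. sqrt (sqrt (cycle_length \<omega> ^ 4))) \<in> borel_measurable M"
    by measurable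
  moreover have "sqrt (sqrt (cycle_length \<omega> ^ 4)) = cycle_length \<omega>" for \<omega>
  proof -
    have "cycle_length \<omega> ^ 4 = ((cycle_length \<omega>)\<^sup>2)\<^sup>2" "0 \<le> cycle_length \<omega>"
      by (simp_all add: cycle_length_def power_mult[symmetric])
    then show ?thesis
      by (simp only: real_sqrt_abs abs_power2 abs_of_nonneg)
  qed
  ultimately show ?thesis by simp
qed

text \<open>Measurability is read off the fourth moment, as for the cycle length. Here the root
  recovers only the square, since the sign of \<open>K\<close> is lost; other indices follow by
  moving the origin.\<close>

lemma measurable_K_xi [measurable]: "(\<lambda>\<omega>. (K (\<xi> n \<omega>))\<^sup>2) \<in> borel_measurable M"
proof -
  have "(\<lambda>\<omega>. K (\<xi> 0 \<omega>) ^ 4) \<in> borel_measurable M"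
    using borel_measurable_integrable[OF K_moment] by (simp cong: measurable_cong_sets)
  then have "(\<lambda>\<omega>. sqrt (K (\<xi> 0 \<omega>) ^ 4)) \<in> borel_measurable M"
    by measurable
  moreover have "sqrt (K (\<xi> 0 \<omega>) ^ 4) = (K (\<xi> 0 \<omega>))\<^sup>2" for \<omega>
    using real_sqrt_abs[of "(K (\<xi> 0 \<omega>))\<^sup>2"] by (simp add: power_mult[symmetric])
  ultimately have [measurable]: "(\<lambda>\<omega>. (K (\<xi> 0 \<omega>))\<^sup>2) \<in> borel_measurable M"
    by simp
  have "(\<lambda>\<omega>. (K (\<xi> 0 (flow (T n \<omega>) \<omega>)))\<^sup>2) \<in> borel_measurable M"
    by measurable
  then show ?thesis
    by (rule measurable_cong[THEN iffD1, rotated]) (simp add: xi_flow)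
qed

text \<open>Arrival \<open>- m\<close> lies in the cycle of arrival 0. The index \<open>- m\<close>
  is left out of the range because that arrival may itself open the cycle.\<close>

definition same_cycle :: "nat \<Rightarrow> 'a \<Rightarrow> bool" where
  "same_cycle m \<omega> \<longleftrightarrow> (\<forall>k\<in>{- int m<..0}. \<not> start k \<omega>)"

text \<open>The contribution of arrival \<open>- m\<close> to the square of the sum of the |K|; the
  factor \<open>cycle_length \<omega>\<close> is the price of Cauchy-Schwarz.\<close>

definition cycle_term :: "nat \<Rightarrow> 'a \<Rightarrow> ennreal" where
  "cycle_term m \<omega> = (if same_cycle m \<omega> then ennreal (cycle_length \<omega> * (K (\<xi> (- int m) \<omega>))\<^sup>2) else 0)"

definition cycle_weight :: "'a \<Rightarrow> ennreal" where
  "cycle_weight \<omega> = (\<Sum>m. cycle_term m \<omega>)"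

lemma measurable_cycle_term [measurable]: "cycle_term m \<in> borel_measurable M"
  unfolding cycle_term_def same_cycle_def by measurable

lemma measurable_cycle_weight [measurable]: "cycle_weight \<in> borel_measurable M"
  unfolding cycle_weight_def by measurable

lemma cycle_weight_ge:
  assumes \<omega>: "\<omega> \<in> space M" and c: "busy_cycle \<omega> i j"
  shows "ennreal ((\<Sum>k\<in>{i..0}. \<bar>K (\<xi> k \<omega>)\<bar>)\<^sup>2) \<le> cycle_weight \<omega>"
proof -
  have ij: "i \<le> 0" "0 < j" and no: "\<And>k. i < k \<Longrightarrow> k < j \<Longrightarrow> \<not> start k \<omega>"
    using c by (auto simp: busy_cycle_def)
  have "(\<Sum>k\<in>{i..0}. \<bar>K (\<xi> k \<omega>)\<bar>)\<^sup>2 \<le> (\<Sum>k\<in>{i..0}. \<bar>K (\<xi> k \<omega>)\<bar>\<^sup>2) * real (card {i..0})"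
    by (rule sum_squared_le_sum_of_squares)
  \<comment> \<open>There are 1 - i indices in the sum, and 1 - i \<le> j - i since \<open>j\<close>
    is at least 1.\<close>
  also have "\<dots> \<le> (\<Sum>k\<in>{i..0}. \<bar>K (\<xi> k \<omega>)\<bar>\<^sup>2) * cycle_length \<omega>"
    using ij by (intro mult_left_mono sum_nonneg) (auto simp: cycle_length[OF \<omega> c])
  also have "\<dots> = (\<Sum>k\<in>{i..0}. cycle_length \<omega> * (K (\<xi> k \<omega>))\<^sup>2)"
    by (simp add: sum_distrib_left mult.commute)
  also have "\<dots> = (\<Sum>m\<in>{..nat (- i)}. cycle_length \<omega> * (K (\<xi> (- int m) \<omega>))\<^sup>2)"
    by (rule sum.reindex_bij_witness[of _ "\<lambda>m. - int m" "\<lambda>k. nat (- k)"]) (use ij in auto)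
  finally have "ennreal ((\<Sum>k\<in>{i..0}. \<bar>K (\<xi> k \<omega>)\<bar>)\<^sup>2)
      \<le> ennreal (\<Sum>m\<in>{..nat (- i)}. cycle_length \<omega> * (K (\<xi> (- int m) \<omega>))\<^sup>2)"
    by (rule ennreal_leI)
  also have "\<dots> = (\<Sum>m\<in>{..nat (- i)}. ennreal (cycle_length \<omega> * (K (\<xi> (- int m) \<omega>))\<^sup>2))"
    by (rule sum_ennreal[symmetric]) (simp add: cycle_length_def)
  also have "\<dots> = (\<Sum>m\<in>{..nat (- i)}. cycle_term m \<omega>)"
    using ij no by (intro sum.cong refl) (auto simp: cycle_term_def same_cycle_def)
  also have "\<dots> \<le> cycle_weight \<omega>"
    unfolding cycle_weight_def by (rule sum_le_suminf) auto
  finally show ?thesis .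
qed

text \<open>Moving to \<open>T 0\<close> changes no index, so it bridges the gap between the origin
  and the right side of \<open>palm_invariant_arrival\<close>.\<close>

lemma cycle_term_flow_origin:
  assumes \<omega>: "\<omega> \<in> space M"
  shows "cycle_term m (flow (T 0 \<omega>) \<omega>) = cycle_term m \<omega>"
proof -
  obtain i j where c: "busy_cycle \<omega> i j"
    using cycle_exists[OF \<omega>] .
  then have "cycle_length (flow (T 0 \<omega>) \<omega>) = cycle_length \<omega>"
    by (intro cycle_length_flow[OF \<omega>]) (auto simp: busy_cycle_def)
  then show ?thesis
    by (simp add: cycle_term_def same_cycle_def start_flow[OF \<omega>] xi_flow[OF \<omega>])
qed

text \<open>Seen from arrival \<open>m\<close>, arrival \<open>- m\<close> is arrival 0, so every
  surviving term carries the same mark \<open>\<xi> 0 \<omega>\<close>. At most \<open>j\<close>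
  terms survive, and \<open>j\<close> does not exceed the cycle length, which yields its second
  power.\<close>

lemma suminf_cycle_term_flow_le:
  assumes \<omega>: "\<omega> \<in> space M"
  shows "(\<Sum>m. cycle_term m (flow (T (int m) \<omega>) \<omega>)) \<le> ennreal ((cycle_length \<omega>)\<^sup>2 * (K (\<xi> 0 \<omega>))\<^sup>2)"
proof -
  obtain i j where c: "busy_cycle \<omega> i j"
    using cycle_exists[OF \<omega>] .
  then have ij: "i \<le> 0" "0 < j" "start j \<omega>"
    by (auto simp: busy_cycle_def)
  let ?x = "cycle_length \<omega> * (K (\<xi> 0 \<omega>))\<^sup>2"
  have x: "0 \<le> ?x"
    by (simp add: cycle_length_def)
  have same: "same_cycle m (flow (T (int m) \<omega>) \<omega>) \<Longrightarrow> int m < j" for m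
  proof (rule ccontr)
    assume s: "same_cycle m (flow (T (int m) \<omega>) \<omega>)" and "\<not> int m < j"
    \<comment> \<open>For m \<ge> j the next cycle has already begun at or before arrival
      \<open>m\<close>; its opening arrival has index j - m when seen from there.\<close>
    then have "j - int m \<in> {- int m<..0}"
      using ij by auto
    with s have "\<not> start (j - int m) (flow (T (int m) \<omega>) \<omega>)"
      unfolding same_cycle_def by blast
    with ij show False
      by (simp add: start_flow[OF \<omega>])
  qed
  have le: "cycle_term m (flow (T (int m) \<omega>) \<omega>) \<le> (if m < nat j then ennreal ?x else 0)" for m
    using same[of m] cycle_length_flow[OF \<omega> c, of "int m"] ij
    by (auto simp: cycle_term_def xi_flow[OF \<omega>])
  have "(\<Sum>m. cycle_term m (flow (T (int m) \<omega>) \<omega>)) = (\<Sum>m<nat j. cycle_term m (flow (T (int m) \<omega>) \<omega>))"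
  proof (rule suminf_finite)
    fix m assume "m \<notin> {..<nat j}"
    then show "cycle_term m (flow (T (int m) \<omega>) \<omega>) = 0"
      using le[of m] by simp
  qed simp
  also have "\<dots> \<le> (\<Sum>m<nat j. ennreal ?x)"
    using le by (intro sum_mono) (metis lessThan_iff)
  also have "\<dots> = ennreal (real (nat j) * ?x)"
    using x by (simp add: ennreal_mult ennreal_of_nat_eq_real_of_nat)
  also have "\<dots> \<le> ennreal (cycle_length \<omega> * ?x)"
    using ij x by (intro ennreal_leI mult_right_mono) (auto simp: cycle_length[OF \<omega> c])
  finally show ?thesis
    by (simp add: power2_eq_square mult.assoc)
qed

text \<open>By invariance of the Palm probability under the shift to the \<open>m\<close>-th arrival, summing over
  the arrivals preceding the origin in its cycle amounts to counting the arrivals following it.\<close>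

lemma cycle_weight_finite: "(\<integral>\<^sup>+\<omega>. cycle_weight \<omega> \<partial>P0) < \<infinity>"
proof -
  have "(\<integral>\<^sup>+\<omega>. cycle_weight \<omega> \<partial>P0) = (\<Sum>m. \<integral>\<^sup>+\<omega>. cycle_term m \<omega> \<partial>P0)"
    unfolding cycle_weight_def by (rule nn_integral_suminf) measurable
  also have "\<dots> = (\<Sum>m. \<integral>\<^sup>+\<omega>. cycle_term m (flow (T (int m) \<omega>) \<omega>) \<partial>P0)"
  proof (rule suminf_cong)
    fix m
    have "(\<integral>\<^sup>+\<omega>. cycle_term m \<omega> \<partial>P0) = (\<integral>\<^sup>+\<omega>. cycle_term m (flow (T 0 \<omega>) \<omega>) \<partial>P0)"
      by (intro nn_integral_cong) (simp add: cycle_term_flow_origin)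
    then show "(\<integral>\<^sup>+\<omega>. cycle_term m \<omega> \<partial>P0) = (\<integral>\<^sup>+\<omega>. cycle_term m (flow (T (int m) \<omega>) \<omega>) \<partial>P0)"
      by (simp add: palm_invariant_arrival[OF measurable_cycle_term])
  qed
  also have "\<dots> = (\<integral>\<^sup>+\<omega>. (\<Sum>m. cycle_term m (flow (T (int m) \<omega>) \<omega>)) \<partial>P0)"
    by (rule nn_integral_suminf[symmetric]) measurable
  also have "\<dots> \<le> (\<integral>\<^sup>+\<omega>. ennreal (cycle_length \<omega> ^ 4 + K (\<xi> 0 \<omega>) ^ 4) \<partial>P0)"
  proof (rule nn_integral_mono)
    fix \<omega> assume "\<omega> \<in> space P0"
    then have "(\<Sum>m. cycle_term m (flow (T (int m) \<omega>) \<omega>))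
        \<le> ennreal ((cycle_length \<omega>)\<^sup>2 * (K (\<xi> 0 \<omega>))\<^sup>2)"
      by (intro suminf_cycle_term_flow_le) simp
    also have "(cycle_length \<omega>)\<^sup>2 * (K (\<xi> 0 \<omega>))\<^sup>2 \<le> cycle_length \<omega> ^ 4 + K (\<xi> 0 \<omega>) ^ 4"
    proof -
      have "2 * ((cycle_length \<omega>)\<^sup>2 * (K (\<xi> 0 \<omega>))\<^sup>2) \<le> cycle_length \<omega> ^ 4 + K (\<xi> 0 \<omega>) ^ 4"
        using sum_squares_bound[of "(cycle_length \<omega>)\<^sup>2" "(K (\<xi> 0 \<omega>))\<^sup>2"]
        by (simp add: mult.assoc power_mult[symmetric])
      moreover have "0 \<le> (cycle_length \<omega>)\<^sup>2 * (K (\<xi> 0 \<omega>))\<^sup>2"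
        by simp
      ultimately show ?thesis
        by linarith
    qed
    finally show "(\<Sum>m. cycle_term m (flow (T (int m) \<omega>) \<omega>))
        \<le> ennreal (cycle_length \<omega> ^ 4 + K (\<xi> 0 \<omega>) ^ 4)"
      by (simp add: ennreal_leI)
  qed
  also have "\<dots> < \<infinity>"
  proof -
    have "integrable P0 (\<lambda>\<omega>. cycle_length \<omega> ^ 4 + K (\<xi> 0 \<omega>) ^ 4)"
      using cycle_moment K_moment by (simp add: cycle_length_def)
    then show ?thesis
      by (simp add: integrable_iff_bounded)
  qed
  finally show ?thesis .
qed

end

section \<open>Palm representation of the expected cost and dominated convergence\<close>

context differentiable_queue
begin

abbreviation cost :: "real \<Rightarrow> real" where
  "cost \<equiv> truncate_at_0 f"

text \<open>The cost accumulated from the origin to the next arrival. The parameter enters only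
  through the workload at the origin, since arrival times do not depend on it.\<close>

definition interval_cost :: "real \<Rightarrow> 'a \<Rightarrow> real" where
  "interval_cost \<theta> \<omega> = window_integral cost (T 1 \<omega>) (W \<theta> 0 \<omega>)"

lemmas cost_mono = mono_truncate_at_0[OF f_mono]
  and cost_nonneg = truncate_at_0_nonneg[OF f_mono]

lemma measurable_cost [measurable]: "cost \<in> borel_measurable borel"
  using cost_mono by (rule borel_measurable_mono)

lemma cost_workload:
  assumes "\<theta> \<in> {a..b}" "\<omega> \<in> space M"
  shows "cost (W \<theta> 0 \<omega>) = f (W \<theta> 0 \<omega>) - f 0"
  using workload_nonneg[OF W_workload[OF assms(1)] assms(2)] by (simp add: truncate_at_0_def)

lemma measurable_workload:
  assumes "\<theta> \<in> {a..b}"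
  shows "W \<theta> 0 \<in> borel_measurable M"
  by (rule stationary_workloadD(1)[OF W_workload[OF assms]])

lemma measurable_interval_cost:
  assumes \<theta>: "\<theta> \<in> {a..b}"
  shows "interval_cost \<theta> \<in> borel_measurable M"
proof -
  note [measurable] = measurable_workload[OF \<theta>]
  have [measurable]: "mono_primitive cost \<in> borel_measurable borel"
    using mono_mono_primitive[OF cost_mono cost_nonneg] by (rule borel_measurable_mono)
  show ?thesis
    unfolding interval_cost_def[abs_def] window_integral_def by measurable
qed

lemma interval_cost_nonneg:
  assumes "\<omega> \<in> space M"
  shows "0 \<le> interval_cost \<theta> \<omega>"
  unfolding interval_cost_def using T_origin[OF assms] cost_nonneg
  by (intro window_integral_nonneg cost_mono) auto

lemma interval_integral_cost:
  assumes \<theta>: "\<theta> \<in> {a..b}" and \<omega>: "\<omega> \<in> space M"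
  shows "interval_integral (\<lambda>\<omega>. ennreal (cost (W \<theta> 0 \<omega>))) \<omega> = ennreal (interval_cost \<theta> \<omega>)"
proof -
  note V = W_workload[OF \<theta>]
  have "interval_integral (\<lambda>\<omega>. ennreal (cost (W \<theta> 0 \<omega>))) \<omega>
      = (\<integral>\<^sup>+u\<in>{0..<T 1 \<omega>}. ennreal (cost (W \<theta> 0 \<omega> - u)) \<partial>lborel)"
    unfolding interval_integral_def
  proof (rule nn_integral_cong)
    fix u :: real
    show "ennreal (cost (W \<theta> 0 (flow u \<omega>))) * indicator {0..<T 1 \<omega>} u
        = ennreal (cost (W \<theta> 0 \<omega> - u)) * indicator {0..<T 1 \<omega>} u"
    proof (cases "u \<in> {0..<T 1 \<omega>}")
      case True
      have "W \<theta> 0 (flow u \<omega>) = max 0 (W \<theta> 0 \<omega> - u)"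
        using workload_flow[OF V \<omega>, of 0 u] workload_decreases[OF V \<omega>, of u] True by simp
      then show ?thesis
        by (simp add: truncate_at_0_def)
    qed simp
  qed
  also have "\<dots> = ennreal (interval_cost \<theta> \<omega>)"
    unfolding interval_cost_def using T_origin[OF \<omega>] cost_nonneg
    by (intro nn_integral_window cost_mono) auto
  finally show ?thesis .
qed

text \<open>Inversion is carried out for the nonnegative truncated cost; positivity of the intensity
  then transfers finiteness of the stationary mean to the Palm side.\<close>

lemma expected_cost:
  assumes \<theta>: "\<theta> \<in> {a..b}"
  shows "integrable P0 (interval_cost \<theta>)"
    and "(\<integral>\<omega>. f (W \<theta> 0 \<omega>) \<partial>M) = f 0 + intensity M T * (\<integral>\<omega>. interval_cost \<theta> \<omega> \<partial>P0)"
proof -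
  note [measurable] = measurable_workload[OF \<theta>] measurable_interval_cost[OF \<theta>]
  let ?J = "\<integral>\<omega>. cost (W \<theta> 0 \<omega>) \<partial>M"
  have int: "integrable M (\<lambda>\<omega>. cost (W \<theta> 0 \<omega>))"
  proof (rule Bochner_Integration.integrable_cong[THEN iffD2, OF refl])
    show "integrable M (\<lambda>\<omega>. f (W \<theta> 0 \<omega>) - f 0)"
      using J_finite[OF \<theta>] by simp
  qed (rule cost_workload[OF \<theta>])
  have J: "?J = (\<integral>\<omega>. f (W \<theta> 0 \<omega>) \<partial>M) - f 0"
  proof -
    have "?J = (\<integral>\<omega>. f (W \<theta> 0 \<omega>) - f 0 \<partial>M)"
      by (rule Bochner_Integration.integral_cong[OF refl]) (rule cost_workload[OF \<theta>])
    then show ?thesis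
      using J_finite[OF \<theta>] by (simp add: prob_space)
  qed
  have J_nonneg: "0 \<le> ?J"
    by (simp add: cost_nonneg)
  have "ennreal (intensity M T) * (\<integral>\<^sup>+\<omega>. ennreal (interval_cost \<theta> \<omega>) \<partial>P0)
      = ennreal (intensity M T) * (\<integral>\<^sup>+\<omega>. interval_integral (\<lambda>\<omega>. ennreal (cost (W \<theta> 0 \<omega>))) \<omega> \<partial>P0)"
    by (intro arg_cong2[where f = "(*)"] refl nn_integral_cong) (simp add: interval_integral_cost[OF \<theta>])
  also have "\<dots> = (\<integral>\<^sup>+\<omega>. ennreal (cost (W \<theta> 0 \<omega>)) \<partial>M)"
    by (rule palm_inversion) measurable
  also have "\<dots> = ennreal ?J"
    using int by (rule nn_integral_eq_integral) (simp add: cost_nonneg)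
  also have "\<dots> = ennreal (intensity M T) * ennreal (?J / intensity M T)"
    using intensity_pos J_nonneg by (simp add: ennreal_mult[symmetric])
  finally have "(\<integral>\<^sup>+\<omega>. ennreal (interval_cost \<theta> \<omega>) \<partial>P0) = ennreal (?J / intensity M T)"
    using intensity_pos by (simp add: ennreal_mult_cancel_left)
  then have "integrable P0 (interval_cost \<theta>) \<and> (\<integral>\<omega>. interval_cost \<theta> \<omega> \<partial>P0) = ?J / intensity M T"
    using J_nonneg intensity_pos interval_cost_nonneg
    by (subst (asm) nn_integral_eq_integrable) auto
  then show "integrable P0 (interval_cost \<theta>)"
    and "(\<integral>\<omega>. f (W \<theta> 0 \<omega>) \<partial>M) = f 0 + intensity M T * (\<integral>\<omega>. interval_cost \<theta> \<omega> \<partial>P0)"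
    using J intensity_pos by simp_all
qed

text \<open>A sum instead of the natural product of Lipschitz constant and cost, so that the two
  parts can be integrated separately.\<close>

definition dominating :: "'a \<Rightarrow> real" where
  "dominating \<omega> = enn2real (cycle_weight \<omega>) + (cost (Wstar 0 \<omega>))\<^sup>2"

lemma integrable_dominating: "integrable P0 dominating"
proof -
  interpret P0: prob_space P0
    by (rule palm_prob_space)
  have [measurable]: "Wstar 0 \<in> borel_measurable M"
    by (rule stationary_workloadD(1)[OF Wstar_workload])
  have [measurable]: "f \<in> borel_measurable borel"
    using f_mono by (rule borel_measurable_mono)
  have "integrable P0 (\<lambda>\<omega>. f (Wstar 0 \<omega>))"
    using f_moment by (rule P0.square_integrable_imp_integrable[rotated]) measurable
  then have "integrable P0 (\<lambda>\<omega>. (f (Wstar 0 \<omega>))\<^sup>2 - 2 * f 0 * f (Wstar 0 \<omega>) + (f 0)\<^sup>2)"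
    using f_moment by simp
  moreover have "(cost (Wstar 0 \<omega>))\<^sup>2 = (f (Wstar 0 \<omega>))\<^sup>2 - 2 * f 0 * f (Wstar 0 \<omega>) + (f 0)\<^sup>2"
    if "\<omega> \<in> space P0" for \<omega>
    using workload_nonneg[OF Wstar_workload, of \<omega>] that
    by (simp add: truncate_at_0_def power2_diff algebra_simps)
  ultimately have "integrable P0 (\<lambda>\<omega>. (cost (Wstar 0 \<omega>))\<^sup>2)"
    by (rule Bochner_Integration.integrable_cong[THEN iffD1, OF refl, OF sym, rotated])
  moreover have "integrable P0 (\<lambda>\<omega>. enn2real (cycle_weight \<omega>))"
  proof (rule integrableI_bounded)
    have "(\<integral>\<^sup>+\<omega>. ennreal (norm (enn2real (cycle_weight \<omega>))) \<partial>P0) \<le> (\<integral>\<^sup>+\<omega>. cycle_weight \<omega> \<partial>P0)"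
      by (intro nn_integral_mono) (simp add: ennreal_enn2real_if)
    then show "(\<integral>\<^sup>+\<omega>. ennreal (norm (enn2real (cycle_weight \<omega>))) \<partial>P0) < \<infinity>"
      using cycle_weight_finite by (rule le_less_trans)
  qed measurable
  ultimately show ?thesis
    unfolding dominating_def[abs_def] by simp
qed

text \<open>Both workloads lie below that of the starred system, so its cost \<open>C\<close> is the
  Lipschitz constant of the window integral there, and the workload contributes \<open>L\<close>.
  The bound is proved where \<open>cycle_weight\<close> is finite, because \<open>enn2real\<close>
  sends \<infinity> to 0.\<close>

lemma interval_cost_Lipschitz:
  assumes \<theta>: "\<theta> \<in> {a..b}" and \<phi>: "\<phi> \<in> {a..b}"
  shows "AE \<omega> in P0. \<bar>interval_cost \<phi> \<omega> - interval_cost \<theta> \<omega>\<bar> \<le> dominating \<omega> * \<bar>\<phi> - \<theta>\<bar>"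
proof -
  have "AE \<omega> in P0. cycle_weight \<omega> \<noteq> \<infinity>"
    using cycle_weight_finite by (intro nn_integral_PInf_AE) auto
  then show ?thesis
  proof (rule AE_mp, intro AE_I2 impI)
    fix \<omega> assume "\<omega> \<in> space P0" and fin: "cycle_weight \<omega> \<noteq> \<infinity>"
    then have \<omega>: "\<omega> \<in> space M" by simp
    obtain i j where c: "busy_cycle \<omega> i j"
      using cycle_exists[OF \<omega>] .
    define L where "L = (\<Sum>k\<in>{i..0}. \<bar>K (\<xi> k \<omega>)\<bar>)"
    define C where "C = cost (Wstar 0 \<omega>)"
    have "ennreal (L\<^sup>2) \<le> ennreal (enn2real (cycle_weight \<omega>))"
      using cycle_weight_ge[OF \<omega> c] fin by (simp add: L_def less_top)
    then have L: "L\<^sup>2 \<le> enn2real (cycle_weight \<omega>)"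
      by simp
    have nonneg: "0 \<le> L" "0 \<le> C"
      by (simp_all add: L_def C_def sum_nonneg cost_nonneg)
    have "\<bar>interval_cost \<phi> \<omega> - interval_cost \<theta> \<omega>\<bar> \<le> \<bar>W \<phi> 0 \<omega> - W \<theta> 0 \<omega>\<bar> * C"
      unfolding interval_cost_def C_def using T_origin[OF \<omega>] W_le_Wstar \<theta> \<phi> \<omega> cost_nonneg
      by (intro window_integral_Lipschitz cost_mono) auto
    also have "\<dots> \<le> (L * \<bar>\<phi> - \<theta>\<bar>) * C"
      using workload_Lipschitz[OF \<omega> c \<theta> \<phi>] nonneg by (intro mult_right_mono) (auto simp: L_def)
    also have "\<dots> = (L * C) * \<bar>\<phi> - \<theta>\<bar>"
      by simp
    also have "\<dots> \<le> dominating \<omega> * \<bar>\<phi> - \<theta>\<bar>"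
    proof (intro mult_right_mono)
      have "2 * (L * C) \<le> L\<^sup>2 + C\<^sup>2"
        using sum_squares_bound[of L C] by (simp add: mult.assoc)
      moreover have "0 \<le> L * C"
        using nonneg by simp
      ultimately show "L * C \<le> dominating \<omega>"
        using L by (simp add: dominating_def C_def)
    qed simp
    finally show "\<bar>interval_cost \<phi> \<omega> - interval_cost \<theta> \<omega>\<bar> \<le> dominating \<omega> * \<bar>\<phi> - \<theta>\<bar>" .
  qed
qed

text \<open>The derivative of the window integral at the current workload, selected by the sign of
  \<sigma> times \<open>W'\<close>, is exactly the bracket in \<open>D\<close>; domination then
  moves the limit through the Palm expectation.\<close>

lemma one_sided_derivative:
  fixes \<theta> \<sigma> :: real and S :: "real set"
  assumes S: "S \<subseteq> {a..b}" "\<theta> \<in> S"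
    and side: "\<And>\<phi>. \<phi> \<in> S \<Longrightarrow> \<phi> \<noteq> \<theta> \<Longrightarrow> 0 < \<sigma> * (\<phi> - \<theta>)"
    and nontrivial: "at \<theta> within S \<noteq> bot"
    and W'_def: "W' = (\<lambda>\<omega>. vector_derivative (\<lambda>\<phi>. W \<phi> 0 \<omega>) (at \<theta> within S))"
    and W1_def: "W1 = (\<lambda>\<omega>. left_lim (\<lambda>t. W \<theta> t \<omega>) (T 1 \<omega>))"
    and D_def: "D = (\<lambda>\<omega>. W' \<omega> * (f (W \<theta> 0 \<omega>) - f (W1 \<omega>) - indicator {x. \<sigma> * x < 0} (W' \<omega>) *
      (measure (interval_measure f) {W \<theta> 0 \<omega>} - measure (interval_measure f) {W1 \<omega>})))"
  shows "AE \<omega> in P0. (\<lambda>\<phi>. W \<phi> 0 \<omega>) differentiable (at \<theta> within S)"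
    and "integrable P0 D"
    and "((\<lambda>\<phi>. \<integral>\<omega>. f (W \<phi> 0 \<omega>) \<partial>M) has_real_derivative intensity M T * (\<integral>\<omega>. D \<omega> \<partial>P0))
      (at \<theta> within S)"
proof -
  have \<theta>: "\<theta> \<in> {a..b}"
    using S by auto
  have W': "((\<lambda>\<phi>. W \<phi> 0 \<omega>) has_real_derivative W' \<omega>) (at \<theta> within S)"
    if \<omega>: "\<omega> \<in> space M" for \<omega>
  proof -
    obtain d where d: "((\<lambda>\<phi>. W \<phi> 0 \<omega>) has_real_derivative d) (at \<theta> within S)"
      using workload_differentiable[OF S side \<omega>] by blast
    then have "W' \<omega> = d"
      unfolding W'_def using nontrivial
      by (intro vector_derivative_within) (auto simp: has_real_derivative_iff_has_vector_derivative)
    with d show ?thesis by simp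
  qed
  then show "AE \<omega> in P0. (\<lambda>\<phi>. W \<phi> 0 \<omega>) differentiable (at \<theta> within S)"
    by (intro AE_I2) (auto simp: real_differentiable_def)
  have D: "((\<lambda>\<phi>. interval_cost \<phi> \<omega>) has_real_derivative D \<omega>) (at \<theta> within S)"
    if \<omega>: "\<omega> \<in> space M" for \<omega>
  proof -
    let ?w = "W \<theta> 0 \<omega>" and ?\<tau> = "T 1 \<omega>"
    let ?\<mu> = "\<lambda>x. measure (interval_measure f) {max 0 x}"
    note right = truncate_at_0_at_right[OF f_cadlag]
    note left = truncate_at_0_at_left[OF f_mono f_cadlag f_left_0]
    have w: "0 \<le> ?w" and w1: "W1 \<omega> = max 0 (?w - ?\<tau>)"
      using workload_nonneg[OF W_workload[OF \<theta>] \<omega>]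
        workload_before_next_arrival[OF W_workload[OF \<theta>] \<omega>] by (auto simp: W1_def)
    have r: "(window_integral cost ?\<tau> has_real_derivative cost ?w - cost (?w - ?\<tau>)) (at_right ?w)"
      unfolding window_integral_def[abs_def]
      by (intro derivative_intros mono_primitive_at_right mono_primitive_shift_at_right[OF _ _ left]
          cost_mono right)
    \<comment> \<open>On the left each end of the window loses its atom; \<open>max 0\<close> in the
      position of the atom matches \<open>W1\<close>, the reflected lower end.\<close>
    have l: "(window_integral cost ?\<tau> has_real_derivative
        (cost ?w - ?\<mu> ?w) - (cost (?w - ?\<tau>) - ?\<mu> (?w - ?\<tau>))) (at_left ?w)"
      unfolding window_integral_def[abs_def]
      by (intro derivative_intros mono_primitive_at_left mono_primitive_shift_at_left
          cost_mono right left)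
    have "((\<lambda>\<phi>. interval_cost \<phi> \<omega>) has_real_derivative
        W' \<omega> * (if \<sigma> * W' \<omega> < 0 then (cost ?w - ?\<mu> ?w) - (cost (?w - ?\<tau>) - ?\<mu> (?w - ?\<tau>))
          else cost ?w - cost (?w - ?\<tau>))) (at \<theta> within S)"
      unfolding interval_cost_def
      by (rule has_real_derivative_one_sided_compose[OF W'[OF \<omega>] _ r l]) (rule side)
    moreover have "W' \<omega> * (if \<sigma> * W' \<omega> < 0
        then (cost ?w - ?\<mu> ?w) - (cost (?w - ?\<tau>) - ?\<mu> (?w - ?\<tau>))
        else cost ?w - cost (?w - ?\<tau>)) = D \<omega>"
      using w by (simp add: D_def w1 truncate_at_0_def)
    ultimately show ?thesis by simp
  qed
  define q where "q \<phi> \<omega> = (interval_cost \<phi> \<omega> - interval_cost \<theta> \<omega>) / (\<phi> - \<theta>)" for \<phi> \<omega>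
  have q_lim: "(\<lambda>n. q (X n) \<omega>) \<longlonglongrightarrow> D \<omega>"
    if X: "\<And>n. X n \<in> S - {\<theta>}" "X \<longlonglongrightarrow> \<theta>" and "\<omega> \<in> space M" for X :: "nat \<Rightarrow> real" and \<omega>
  proof -
    have "((\<lambda>\<phi>. q \<phi> \<omega>) \<longlongrightarrow> D \<omega>) (at \<theta> within S)"
      using D[OF \<open>\<omega> \<in> space M\<close>] by (simp add: has_field_derivative_iff q_def)
    moreover have "filterlim X (at \<theta> within S) sequentially"
      using X by (auto simp: filterlim_at)
    ultimately show ?thesis
      by (rule filterlim_compose)
  qed
  have q_meas: "q \<phi> \<in> borel_measurable P0" if "\<phi> \<in> S" for \<phi>
  proof -
    have [measurable]: "interval_cost \<phi> \<in> borel_measurable M" "interval_cost \<theta> \<in> borel_measurable M"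
      using that S \<theta> by (auto intro: measurable_interval_cost)
    show ?thesis
      unfolding q_def[abs_def] by measurable
  qed
  have q_dom: "AE \<omega> in P0. norm (q \<phi> \<omega>) \<le> dominating \<omega>" if "\<phi> \<in> S - {\<theta>}" for \<phi>
  proof -
    have "\<phi> \<in> {a..b}" "\<phi> \<noteq> \<theta>"
      using that S by auto
    with interval_cost_Lipschitz[OF \<theta>, of \<phi>] show ?thesis
      by (auto simp: q_def pos_divide_le_eq elim!: eventually_mono)
  qed
  \<comment> \<open>\<open>W'\<close> is defined pathwise by \<open>vector_derivative\<close>, so
    measurability of \<open>D\<close> is obtained from the measurable quotients converging to
    it.\<close>
  have D_meas: "D \<in> borel_measurable P0"
  proof -
    obtain X where X: "\<And>n. X n \<in> S - {\<theta>}" "X \<longlonglongrightarrow> \<theta>"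
      using nontrivial by (auto simp: trivial_limit_within islimpt_sequential)
    show ?thesis
      by (rule borel_measurable_LIMSEQ_real[of _ "\<lambda>n. q (X n)"])
         (use X q_lim q_meas in auto)
  qed
  have dct: "integrable P0 D" "(\<lambda>n. \<integral>\<omega>. q (X n) \<omega> \<partial>P0) \<longlonglongrightarrow> (\<integral>\<omega>. D \<omega> \<partial>P0)"
    if X: "\<And>n. X n \<in> S - {\<theta>}" "X \<longlonglongrightarrow> \<theta>" for X :: "nat \<Rightarrow> real"
  proof -
    have m: "q (X n) \<in> borel_measurable P0" for n
      using X q_meas by blast
    have l: "AE \<omega> in P0. (\<lambda>n. q (X n) \<omega>) \<longlonglongrightarrow> D \<omega>"
      by (rule AE_I2) (simp add: q_lim[OF X])
    have d: "AE \<omega> in P0. norm (q (X n) \<omega>) \<le> dominating \<omega>" for n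
      by (rule q_dom[OF X(1)])
    show "integrable P0 D" "(\<lambda>n. \<integral>\<omega>. q (X n) \<omega> \<partial>P0) \<longlonglongrightarrow> (\<integral>\<omega>. D \<omega> \<partial>P0)"
      by (rule integrable_dominated_convergence[OF D_meas m integrable_dominating l d])
         (rule integral_dominated_convergence[OF D_meas m integrable_dominating l d])
  qed
  show "integrable P0 D"
    using nontrivial dct(1) by (auto simp: trivial_limit_within islimpt_sequential)
  have quotient: "((\<integral>\<omega>. f (W \<phi> 0 \<omega>) \<partial>M) - (\<integral>\<omega>. f (W \<theta> 0 \<omega>) \<partial>M)) / (\<phi> - \<theta>)
      = intensity M T * (\<integral>\<omega>. q \<phi> \<omega> \<partial>P0)" if "\<phi> \<in> S" for \<phi>
  proof -
    have \<phi>: "\<phi> \<in> {a..b}"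
      using that S by auto
    have "(\<integral>\<omega>. q \<phi> \<omega> \<partial>P0)
        = ((\<integral>\<omega>. interval_cost \<phi> \<omega> \<partial>P0) - (\<integral>\<omega>. interval_cost \<theta> \<omega> \<partial>P0)) / (\<phi> - \<theta>)"
      unfolding q_def using expected_cost(1)[OF \<theta>] expected_cost(1)[OF \<phi>] by simp
    then show ?thesis
      by (simp add: expected_cost(2)[OF \<theta>] expected_cost(2)[OF \<phi>] right_diff_distrib)
  qed
  show "((\<lambda>\<phi>. \<integral>\<omega>. f (W \<phi> 0 \<omega>) \<partial>M) has_real_derivative intensity M T * (\<integral>\<omega>. D \<omega> \<partial>P0))
      (at \<theta> within S)"
    unfolding has_field_derivative_iff tendsto_at_iff_sequentially
  proof (intro allI impI)
    fix X :: "nat \<Rightarrow> real" assume X: "\<forall>n. X n \<in> S - {\<theta>}" "X \<longlonglongrightarrow> \<theta>"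
    have "(\<lambda>n. intensity M T * (\<integral>\<omega>. q (X n) \<omega> \<partial>P0)) \<longlonglongrightarrow> intensity M T * (\<integral>\<omega>. D \<omega> \<partial>P0)"
      using X by (intro tendsto_mult tendsto_const dct(2)) auto
    then show "((\<lambda>\<phi>. ((\<integral>\<omega>. f (W \<phi> 0 \<omega>) \<partial>M) - (\<integral>\<omega>. f (W \<theta> 0 \<omega>) \<partial>M)) / (\<phi> - \<theta>)) \<circ> X)
        \<longlonglongrightarrow> intensity M T * (\<integral>\<omega>. D \<omega> \<partial>P0)"
      using X quotient by (auto simp: comp_def)
  qed
qed

end

theorem theorem1:
  fixes M P0 :: "'a measure"
    and flow :: "real \<Rightarrow> 'a \<Rightarrow> 'a"
    and T \<xi> R :: "int \<Rightarrow> 'a \<Rightarrow> real"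
    and a b :: real
    and F :: "real \<Rightarrow> real \<Rightarrow> real"
    and W :: "real \<Rightarrow> real \<Rightarrow> 'a \<Rightarrow> real"
    and Wstar :: "real \<Rightarrow> 'a \<Rightarrow> real"
    and f K :: "real \<Rightarrow> real"
  assumes queue: "gg1_queue M flow T P0 {a..b} F \<xi> W Wstar R"
    and "a \<le> b"
    and f_mono: "mono f"
    and f_cadlag: "cadlag f"
    and f_left_0: "(f \<longlongrightarrow> f 0) (at_left 0)"
    and J_finite: "\<And>\<theta>. \<theta> \<in> {a..b} \<Longrightarrow> integrable M (\<lambda>\<omega>. f (W \<theta> 0 \<omega>))"
    and G_differentiable:
      "\<And>u \<theta>. u \<in> {0..<1} \<Longrightarrow> \<theta> \<in> {a..b} \<Longrightarrow> quantile F u differentiable (at \<theta> within {a..b})"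
    and G_Lipschitz:
      "\<And>u \<theta>1 \<theta>2. u \<in> {0..<1} \<Longrightarrow> \<theta>1 \<in> {a..b} \<Longrightarrow> \<theta>2 \<in> {a..b} \<Longrightarrow>
         \<bar>quantile F u \<theta>1 - quantile F u \<theta>2\<bar> \<le> K u * \<bar>\<theta>1 - \<theta>2\<bar>"
    and max_service_integrable: "integrable P0 (max_service F \<xi> {a..b} 0)"
    and max_load: "intensity M T * (\<integral>\<omega>. max_service F \<xi> {a..b} 0 \<omega> \<partial>P0) < 1"
    and K_moment: "integrable P0 (\<lambda>\<omega>. K (\<xi> 0 \<omega>) ^ 4)"
    and cycle_moment:
      "integrable P0 (\<lambda>\<omega>. measure (arrivals T \<omega>) {R 0 \<omega>..<R 1 \<omega>} ^ 4)"
    and f_moment: "integrable P0 (\<lambda>\<omega>. f (Wstar 0 \<omega>) ^ 2)"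
  shows
    "(\<forall>\<theta>\<in>{a..<b}.
       let W' = (\<lambda>\<omega>. vector_derivative (\<lambda>\<phi>. W \<phi> 0 \<omega>) (at_right \<theta>));
           W1 = (\<lambda>\<omega>. left_lim (\<lambda>t. W \<theta> t \<omega>) (T 1 \<omega>));
           D = (\<lambda>\<omega>. W' \<omega> * (f (W \<theta> 0 \<omega>) - f (W1 \<omega>)
                  - indicator {..<0} (W' \<omega>) *
                    (measure (interval_measure f) {W \<theta> 0 \<omega>} - measure (interval_measure f) {W1 \<omega>})))
       in (AE \<omega> in P0. (\<lambda>\<phi>. W \<phi> 0 \<omega>) differentiable (at_right \<theta>)) \<and>
          integrable P0 D \<and>
          ((\<lambda>\<phi>. \<integral>\<omega>. f (W \<phi> 0 \<omega>) \<partial>M) has_real_derivative intensity M T * (\<integral>\<omega>. D \<omega> \<partial>P0))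
            (at_right \<theta>)) \<and>
     (\<forall>\<theta>\<in>{a<..b}.
       let W' = (\<lambda>\<omega>. vector_derivative (\<lambda>\<phi>. W \<phi> 0 \<omega>) (at_left \<theta>));
           W1 = (\<lambda>\<omega>. left_lim (\<lambda>t. W \<theta> t \<omega>) (T 1 \<omega>));
           D = (\<lambda>\<omega>. W' \<omega> * (f (W \<theta> 0 \<omega>) - f (W1 \<omega>)
                  - indicator {0<..} (W' \<omega>) *
                    (measure (interval_measure f) {W \<theta> 0 \<omega>} - measure (interval_measure f) {W1 \<omega>})))
       in (AE \<omega> in P0. (\<lambda>\<phi>. W \<phi> 0 \<omega>) differentiable (at_left \<theta>)) \<and>
          integrable P0 D \<and>
          ((\<lambda>\<phi>. \<integral>\<omega>. f (W \<phi> 0 \<omega>) \<partial>M) has_real_derivative intensity M T * (\<integral>\<omega>. D \<omega> \<partial>P0))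
            (at_left \<theta>))"
proof -
  interpret differentiable_queue M flow T P0 a b F \<xi> W Wstar R f K
    using assms by (intro differentiable_queue.intro differentiable_queue_axioms.intro)
  \<comment> \<open>The two indicator sets of the formulas are the set of \<open>x\<close> with
    \<sigma> * x < 0, for \<sigma> = 1 on [\<theta>, b] and \<sigma> = -1 on [a, \<theta>].\<close>
  have neg: "{x :: real. 1 * x < 0} = {..<0}" and pos: "{x :: real. - 1 * x < 0} = {0<..}"
    by auto
  show ?thesis
  proof (intro conjI[of "Ball _ _" "Ball _ _"] ballI)
    fix \<theta> assume \<theta>: "\<theta> \<in> {a..<b}"
    then have right: "at_right \<theta> = at \<theta> within {\<theta>..b}"
      by (simp add: at_within_Icc_at_right)
    then have nontrivial: "at \<theta> within {\<theta>..b} \<noteq> bot"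
      by (metis trivial_limit_at_right_real)
    show "let W' = (\<lambda>\<omega>. vector_derivative (\<lambda>\<phi>. W \<phi> 0 \<omega>) (at_right \<theta>));
           W1 = (\<lambda>\<omega>. left_lim (\<lambda>t. W \<theta> t \<omega>) (T 1 \<omega>));
           D = (\<lambda>\<omega>. W' \<omega> * (f (W \<theta> 0 \<omega>) - f (W1 \<omega>)
                  - indicator {..<0} (W' \<omega>) *
                    (measure (interval_measure f) {W \<theta> 0 \<omega>} - measure (interval_measure f) {W1 \<omega>})))
       in (AE \<omega> in P0. (\<lambda>\<phi>. W \<phi> 0 \<omega>) differentiable (at_right \<theta>)) \<and>
          integrable P0 D \<and>
          ((\<lambda>\<phi>. \<integral>\<omega>. f (W \<phi> 0 \<omega>) \<partial>M) has_real_derivative intensity M T * (\<integral>\<omega>. D \<omega> \<partial>P0))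
            (at_right \<theta>)"
      unfolding Let_def right neg[symmetric] using \<theta>
      by (intro conjI one_sided_derivative[OF _ _ _ nontrivial refl refl refl, where \<sigma> = 1]) auto
  next
    fix \<theta> assume \<theta>: "\<theta> \<in> {a<..b}"
    then have left: "at_left \<theta> = at \<theta> within {a..\<theta>}"
      by (simp add: at_within_Icc_at_left)
    then have nontrivial: "at \<theta> within {a..\<theta>} \<noteq> bot"
      by (metis trivial_limit_at_left_real)
    show "let W' = (\<lambda>\<omega>. vector_derivative (\<lambda>\<phi>. W \<phi> 0 \<omega>) (at_left \<theta>));
           W1 = (\<lambda>\<omega>. left_lim (\<lambda>t. W \<theta> t \<omega>) (T 1 \<omega>));
           D = (\<lambda>\<omega>. W' \<omega> * (f (W \<theta> 0 \<omega>) - f (W1 \<omega>)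
                  - indicator {0<..} (W' \<omega>) *
                    (measure (interval_measure f) {W \<theta> 0 \<omega>} - measure (interval_measure f) {W1 \<omega>})))
       in (AE \<omega> in P0. (\<lambda>\<phi>. W \<phi> 0 \<omega>) differentiable (at_left \<theta>)) \<and>
          integrable P0 D \<and>
          ((\<lambda>\<phi>. \<integral>\<omega>. f (W \<phi> 0 \<omega>) \<partial>M) has_real_derivative intensity M T * (\<integral>\<omega>. D \<omega> \<partial>P0))
            (at_left \<theta>)"
      unfolding Let_def left pos[symmetric] using \<theta>
      by (intro conjI one_sided_derivative[OF _ _ _ nontrivial refl refl refl, where \<sigma> = "- 1"]) auto
  qed
qed

end
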